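(* Let $n\ge1$ and let $w\in K(B_n)$ be a separable signed permutation. Then $$F(\Lambda_w^B,q)=F(\Lambda_{\mathrm{st}(w)}^S,q)\cdot\prod_{i\in\mathrm{Neg}(w)}(i),\qquad F(V_w^B,q)=F(V_{\mathrm{st}(w)}^S,q)\cdot\prod_{i\in[n]\setminus\mathrm{Neg}(w)}(i),$$ where $(i)=1+q^i$.
   Context: $[n]=\{1,\dots,n\}$, $\bar a=-a$. $S_n$ is the symmetric group on $[n]$. $B_n$ is the group of signed permutations: bijections $w$ of $\{\pm1,\dots,\pm n\}$ with $w(-i)=-w(i)$, written $w=w_1\cdots w_n$, $w_i=w(i)$. $\mathrm{Neg}(w)=\{i\in[n]:w_i<0\}$. $\mathrm{st}(w)\in S_n$ is the permutation with the same relative order (as integers) as $w_1,\dots,w_n$. For a word $a=a_1\cdots a_m$ of nonzero integers with distinct absolute values, $\mathrm{sts}(a)\in B_m$ is the signed permutation whose $i$-th entry has the sign of $a_i$ and whose absolute values have the same relative order as $|a_1|,\dots,|a_m|$. $w$ contains the pattern $u\in B_m$ if $\mathrm{sts}(w_{i_1}\cdots w_{i_m})=u$ for some $i_1<\cdots<i_m$; otherwise it avoids $u$. $K(B_n)$ is the set of separable $w\in B_n$, i.e. those avoiding $\bar21$, $2\bar1$, $3142$, $2413$, $\bar3\,\bar1\,\bar4\,\bar2$, $\bar2\,\bar4\,\bar1\,\bar3$. In $W=S_n$ or $W=B_n$, the left weak order is $u\le_L w$ iff $\ell(w)=\ell(u)+\ell(wu^{-1})$, where $\ell$ is Coxeter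 length with respect to the standard generators (adjacent transpositions, and for $B_n$ also $s_0=\bar1\,2\cdots n$) and $(uv)(i)=u(v(i))$. Explicitly, for $w\in B_n$, $\ell(w)=\#\{i:w_i<0\}+\#\{i<j:w_i>w_j\}+\#\{i<j:w_i+w_j<0\}$, and for $w\in S_n$ it is the number of inversions. For $w\in B_n$: $\Lambda_w^B=\{u\in B_n:u\le_L w\}$, $V_w^B=\{u\in B_n:w\le_L u\}$; for $w\in S_n$: $\Lambda_w^S=\{u\in S_n:u\le_L w\}$, $V_w^S=\{u\in S_n:w\le_L u\}$. Rank generating functions: $F(\Lambda_w,q)=\sum_{u\in\Lambda_w}q^{\ell(u)}$ and $F(V_w,q)=\sum_{u\in V_w}q^{\ell(u)-\ell(w)}$. Empty products are $1$. *)

theory Defs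
  imports "HOL-Combinatorics.Permutations" "HOL-Computational_Algebra.Polynomial"
begin

section \<open>Permutations and signed permutations\<close>

text \<open>
  Elements of both groups are functions \<open>int \<Rightarrow> int\<close> that fix every integer outside
  \<open>{1..n}\<close>, respectively \<open>{-n..n} - {0}\<close>; products are compositions, \<open>(u \<circ> v) i = u (v i)\<close>,
  and inverses are given by \<open>inv\<close>.
\<close>

definition sym_grp :: "nat \<Rightarrow> (int \<Rightarrow> int) set" where
  "sym_grp n = {w. w permutes {1..int n}}"

definition signed_grp :: "nat \<Rightarrow> (int \<Rightarrow> int) set" where
  "signed_grp n = {w. w permutes ({- int n..int n} - {0}) \<and> (\<forall>i. w (- i) = - w i)}"

definition Neg :: "nat \<Rightarrow> (int \<Rightarrow> int) \<Rightarrow> int set" where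
  "Neg n w = {i \<in> {1..int n}. w i < 0}"

text \<open>
  The permutation with the same relative order as \<open>w\<^sub>1, \<dots>, w\<^sub>n\<close>: the \<open>i\<close>-th entry is the rank
  of \<open>w i\<close>; see \<open>st_in_sym_grp\<close>, \<open>st_less_iff\<close> and \<open>st_unique\<close>.
\<close>

definition st :: "nat \<Rightarrow> (int \<Rightarrow> int) \<Rightarrow> int \<Rightarrow> int" where
  "st n w i = (if i \<in> {1..int n} then int (card {j \<in> {1..int n}. w j \<le> w i}) else i)"

section \<open>Patterns and separability\<close>

text \<open>
  Words, in particular the one-line notations \<open>w\<^sub>1 \<cdots> w\<^sub>m\<close> of elements of \<open>B\<^sub>m\<close>,
  are lists of integers here.
\<close>

definition sts :: "int list \<Rightarrow> int list" where
  "sts a = map (\<lambda>x. sgn x * int (card {y \<in> set a. \<bar>y\<bar> \<le> \<bar>x\<bar>})) a"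

definition contains_pattern :: "nat \<Rightarrow> (int \<Rightarrow> int) \<Rightarrow> int list \<Rightarrow> bool" where
  "contains_pattern n w u \<longleftrightarrow>
     (\<exists>is. sorted_wrt (<) is \<and> set is \<subseteq> {1..int n} \<and> length is = length u \<and> sts (map w is) = u)"

definition separable_signed :: "nat \<Rightarrow> (int \<Rightarrow> int) set" where
  "separable_signed n = {w \<in> signed_grp n.
     \<forall>u \<in> {[-2, 1], [2, -1], [3, 1, 4, 2], [2, 4, 1, 3], [-3, -1, -4, -2], [-2, -4, -1, -3]}.
       \<not> contains_pattern n w u}"

section \<open>Coxeter length and left weak order\<close>

definition sym_gens :: "nat \<Rightarrow> (int \<Rightarrow> int) set" where
  "sym_gens n = {transpose i (i + 1) |i. i \<in> {1..<int n}}"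

definition signed_gens :: "nat \<Rightarrow> (int \<Rightarrow> int) set" where
  "signed_gens n = (if n \<ge> 1 then {transpose 1 (- 1)} else {}) \<union>
     {transpose i (i + 1) \<circ> transpose (- i) (- (i + 1)) |i. i \<in> {1..<int n}}"

definition cox_length :: "(int \<Rightarrow> int) set \<Rightarrow> (int \<Rightarrow> int) \<Rightarrow> nat" where
  "cox_length S w = (LEAST k. \<exists>ss. length ss = k \<and> set ss \<subseteq> S \<and> foldr (\<circ>) ss id = w)"

abbreviation length_S :: "nat \<Rightarrow> (int \<Rightarrow> int) \<Rightarrow> nat" where
  "length_S n \<equiv> cox_length (sym_gens n)"

abbreviation length_B :: "nat \<Rightarrow> (int \<Rightarrow> int) \<Rightarrow> nat" where
  "length_B n \<equiv> cox_length (signed_gens n)"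

definition left_weak_le :: "((int \<Rightarrow> int) \<Rightarrow> nat) \<Rightarrow> (int \<Rightarrow> int) \<Rightarrow> (int \<Rightarrow> int) \<Rightarrow> bool" where
  "left_weak_le len u w \<longleftrightarrow> len w = len u + len (w \<circ> inv u)"

definition Lambda_S :: "nat \<Rightarrow> (int \<Rightarrow> int) \<Rightarrow> (int \<Rightarrow> int) set" where
  "Lambda_S n w = {u \<in> sym_grp n. left_weak_le (length_S n) u w}"

definition V_S :: "nat \<Rightarrow> (int \<Rightarrow> int) \<Rightarrow> (int \<Rightarrow> int) set" where
  "V_S n w = {u \<in> sym_grp n. left_weak_le (length_S n) w u}"

definition Lambda_B :: "nat \<Rightarrow> (int \<Rightarrow> int) \<Rightarrow> (int \<Rightarrow> int) set" where
  "Lambda_B n w = {u \<in> signed_grp n. left_weak_le (length_B n) u w}"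

definition V_B :: "nat \<Rightarrow> (int \<Rightarrow> int) \<Rightarrow> (int \<Rightarrow> int) set" where
  "V_B n w = {u \<in> signed_grp n. left_weak_le (length_B n) w u}"

text \<open>
  Rank generating functions as polynomials in \<open>q\<close>. The subtraction of natural numbers in
  \<open>F_V\<close> does not truncate, since \<open>w \<le>\<^sub>L u\<close> gives \<open>\<ell>(w) \<le> \<ell>(u)\<close>.
\<close>

definition F_Lambda_S :: "nat \<Rightarrow> (int \<Rightarrow> int) \<Rightarrow> int poly" where
  "F_Lambda_S n w = (\<Sum>u\<in>Lambda_S n w. monom 1 (length_S n u))"

definition F_V_S :: "nat \<Rightarrow> (int \<Rightarrow> int) \<Rightarrow> int poly" where
  "F_V_S n w = (\<Sum>u\<in>V_S n w. monom 1 (length_S n u - length_S n w))"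

definition F_Lambda_B :: "nat \<Rightarrow> (int \<Rightarrow> int) \<Rightarrow> int poly" where
  "F_Lambda_B n w = (\<Sum>u\<in>Lambda_B n w. monom 1 (length_B n u))"

definition F_V_B :: "nat \<Rightarrow> (int \<Rightarrow> int) \<Rightarrow> int poly" where
  "F_V_B n w = (\<Sum>u\<in>V_B n w. monom 1 (length_B n u - length_B n w))"

definition q_paren :: "int \<Rightarrow> int poly" where
  "q_paren i = 1 + monom 1 (nat i)"

section \<open>Adequacy of the definitions\<close>

lemma finite_sym_grp: "finite (sym_grp n)"
  unfolding sym_grp_def by (simp add: finite_permutations)

lemma finite_signed_grp: "finite (signed_grp n)"
proof -
  have "finite {w. w permutes ({- int n..int n} - {0})}"
    by (rule finite_permutations) simp
  then show ?thesis
    unfolding signed_grp_def by (rule rev_finite_subset) auto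
qed

lemma signed_grp_inj: "w \<in> signed_grp n \<Longrightarrow> inj w"
  by (auto simp: signed_grp_def permutes_inj)

lemma sym_grp_inj: "w \<in> sym_grp n \<Longrightarrow> inj w"
  by (auto simp: sym_grp_def permutes_inj)

lemma card_rank_less:
  fixes f :: "'a \<Rightarrow> int"
  assumes "finite A" "x \<in> A" "y \<in> A"
  shows "card {z \<in> A. f z \<le> f x} < card {z \<in> A. f z \<le> f y} \<longleftrightarrow> f x < f y"
proof
  assume "f x < f y"
  then have "{z \<in> A. f z \<le> f x} \<subseteq> {z \<in> A. f z \<le> f y}" by auto
  moreover from \<open>f x < f y\<close> have "y \<in> {z \<in> A. f z \<le> f y} - {z \<in> A. f z \<le> f x}"
    using assms by simp
  ultimately have "{z \<in> A. f z \<le> f x} \<subset> {z \<in> A. f z \<le> f y}"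
    by blast
  then show "card {z \<in> A. f z \<le> f x} < card {z \<in> A. f z \<le> f y}"
    using assms by (intro psubset_card_mono) auto
next
  assume lt: "card {z \<in> A. f z \<le> f x} < card {z \<in> A. f z \<le> f y}"
  show "f x < f y"
  proof (rule ccontr)
    assume "\<not> f x < f y"
    then have "card {z \<in> A. f z \<le> f y} \<le> card {z \<in> A. f z \<le> f x}"
      using assms by (intro card_mono) auto
    with lt show False by simp
  qed
qed

lemma st_less_iff:
  assumes "i \<in> {1..int n}" "j \<in> {1..int n}"
  shows "st n w i < st n w j \<longleftrightarrow> w i < w j"
  using assms card_rank_less[of "{1..int n}" i j w] by (simp add: st_def)

lemma st_in_sym_grp:
  assumes "inj w"
  shows "st n w \<in> sym_grp n"
proof -
  have inj: "inj_on (st n w) {1..int n}"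
  proof (rule inj_onI)
    fix i j assume ij: "i \<in> {1..int n}" "j \<in> {1..int n}" "st n w i = st n w j"
    then have "w i = w j"
      using st_less_iff[of i n j w] st_less_iff[of j n i w] by linarith
    then show "i = j" using assms by (simp add: inj_eq)
  qed
  have "st n w ` {1..int n} \<subseteq> {1..int n}"
  proof
    fix k assume "k \<in> st n w ` {1..int n}"
    then obtain i where i: "i \<in> {1..int n}" "k = int (card {j \<in> {1..int n}. w j \<le> w i})"
      by (auto simp: st_def)
    have "card {j \<in> {1..int n}. w j \<le> w i} \<le> card {1..int n}"
      by (intro card_mono) auto
    moreover have "card {j \<in> {1..int n}. w j \<le> w i} > 0"
      using i by (subst card_gt_0_iff) (auto intro: rev_finite_subset[of "{1..int n}"])
    ultimately show "k \<in> {1..int n}" using i by auto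
  qed
  then have "bij_betw (st n w) {1..int n} {1..int n}"
    using inj by (simp add: bij_betw_def card_image card_subset_eq)
  then show ?thesis
    unfolding sym_grp_def by (auto intro!: bij_imp_permutes simp: st_def)
qed

lemma strict_increasing_interval_id:
  fixes f :: "int \<Rightarrow> int"
  assumes maps: "\<And>i. i \<in> {1..int n} \<Longrightarrow> f i \<in> {1..int n}"
    and inc: "\<And>i. i \<in> {1..<int n} \<Longrightarrow> f i < f (i + 1)"
    and i: "i \<in> {1..int n}"
  shows "f i = i"
proof -
  have lower: "k < n \<Longrightarrow> f (int k + 1) \<ge> int k + 1" for k
  proof (induction k)
    case 0
    then show ?case using maps[of 1] by simp
  next
    case (Suc k)
    then show ?case using inc[of "int k + 1"] by (simp add: add.commute)
  qed
  have upper: "k < n \<Longrightarrow> f (int n - int k) \<le> int n - int k" for k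
  proof (induction k)
    case 0
    then show ?case using maps[of "int n"] by simp
  next
    case (Suc k)
    have "int n - int (Suc k) + 1 = int n - int k" by simp
    then show ?case using Suc inc[of "int n - int (Suc k)"] by simp
  qed
  show ?thesis
    using lower[of "nat (i - 1)"] upper[of "nat (int n - i)"] i by (simp add: nat_less_iff)
qed

lemma st_unique:
  assumes "inj w" and v: "v \<in> sym_grp n"
    and ord: "\<And>i j. i \<in> {1..int n} \<Longrightarrow> j \<in> {1..int n} \<Longrightarrow> v i < v j \<longleftrightarrow> w i < w j"
  shows "v = st n w"
proof
  fix i
  show "v i = st n w i"
  proof (cases "i \<in> {1..int n}")
    case True
    have vperm: "v permutes {1..int n}" using v by (simp add: sym_grp_def)
    have "{j \<in> {1..int n}. w j \<le> w i} = {j \<in> {1..int n}. v j \<le> v i}"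
      using ord[of i] True by (auto simp: not_less[symmetric])
    moreover have "v ` {j \<in> {1..int n}. v j \<le> v i} = {1..v i}"
    proof
      show "v ` {j \<in> {1..int n}. v j \<le> v i} \<subseteq> {1..v i}"
        using permutes_in_image[OF vperm] by (auto simp del: atLeastAtMost_iff) auto
      show "{1..v i} \<subseteq> v ` {j \<in> {1..int n}. v j \<le> v i}"
      proof
        fix k assume k: "k \<in> {1..v i}"
        then have "k \<in> {1..int n}" using permutes_in_image[OF vperm, of i] True by simp
        then obtain j where "j \<in> {1..int n}" "v j = k"
          using permutes_image[OF vperm] by (metis imageE)
        then show "k \<in> v ` {j \<in> {1..int n}. v j \<le> v i}" using k by auto
      qed
    qed
    then have "card {j \<in> {1..int n}. v j \<le> v i} = card {1..v i}"
      by (metis card_image inj_on_subset permutes_inj vperm subset_UNIV)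
    moreover have "v i \<ge> 1" using permutes_in_image[OF vperm, of i] True by simp
    ultimately show ?thesis using True by (simp add: st_def)
  next
    case False
    then show ?thesis using v by (auto simp: sym_grp_def st_def permutes_def)
  qed
qed

lemma sts_adequate:
  assumes "0 \<notin> set a" and dist: "distinct (map abs a)"
  shows length_sts: "length (sts a) = length a"
    and sgn_sts: "\<And>i. i < length a \<Longrightarrow> sgn (sts a ! i) = sgn (a ! i)"
    and abs_sts_less_iff: "\<And>i j. i < length a \<Longrightarrow> j < length a \<Longrightarrow>
          \<bar>sts a ! i\<bar> < \<bar>sts a ! j\<bar> \<longleftrightarrow> \<bar>a ! i\<bar> < \<bar>a ! j\<bar>"
    and abs_sts_image: "abs ` set (sts a) = {1..int (length a)}"
proof -
  let ?r = "\<lambda>x. card {y \<in> set a. \<bar>y\<bar> \<le> \<bar>x\<bar>}"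
  have pos: "?r x > 0" if "x \<in> set a" for x
    using that by (auto simp: card_gt_0_iff)
  show "length (sts a) = length a" by (simp add: sts_def)
  have absr: "\<bar>sgn x * int (?r x)\<bar> = int (?r x)" if "x \<in> set a" for x
    using that assms(1) by (auto simp: abs_mult sgn_if)
  show "sgn (sts a ! i) = sgn (a ! i)" if "i < length a" for i
    using that pos[of "a ! i"] by (simp add: sts_def sgn_mult)
  show "\<bar>sts a ! i\<bar> < \<bar>sts a ! j\<bar> \<longleftrightarrow> \<bar>a ! i\<bar> < \<bar>a ! j\<bar>"
    if "i < length a" "j < length a" for i j
    using that absr card_rank_less[of "set a" "a ! i" "a ! j" abs] by (simp add: sts_def)
  have d: "distinct a" and inj: "inj_on abs (set a)"
    using dist by (auto simp: distinct_map)
  have img: "abs ` set (sts a) = (\<lambda>x. int (?r x)) ` set a"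
    using absr by (auto simp: sts_def image_image intro!: image_cong)
  have "inj_on (\<lambda>x. int (?r x)) (set a)"
  proof (rule inj_onI)
    fix x y assume xy: "x \<in> set a" "y \<in> set a" "int (?r x) = int (?r y)"
    then have "\<bar>x\<bar> = \<bar>y\<bar>"
      using card_rank_less[of "set a" x y abs] card_rank_less[of "set a" y x abs] by simp
    then show "x = y" using inj xy by (auto dest: inj_onD)
  qed
  then have c: "card ((\<lambda>x. int (?r x)) ` set a) = length a"
    using d by (simp add: card_image distinct_card)
  have "(\<lambda>x. int (?r x)) ` set a \<subseteq> {1..int (length a)}"
  proof
    fix k assume "k \<in> (\<lambda>x. int (?r x)) ` set a"
    then obtain x where x: "x \<in> set a" "k = int (?r x)" by auto
    have "?r x \<le> card (set a)" by (intro card_mono) auto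
    then show "k \<in> {1..int (length a)}"
      using x pos[of x] d by (simp add: distinct_card)
  qed
  then show "abs ` set (sts a) = {1..int (length a)}"
    unfolding img by (intro card_subset_eq) (simp_all add: c)
qed

text \<open>The explicit formulas for the Coxeter length.\<close>

definition inversions :: "nat \<Rightarrow> (int \<Rightarrow> int) \<Rightarrow> (int \<times> int) set" where
  "inversions n w = {(i, j). 1 \<le> i \<and> i < j \<and> j \<le> int n \<and> w i > w j}"

definition neg_sum_pairs :: "nat \<Rightarrow> (int \<Rightarrow> int) \<Rightarrow> (int \<times> int) set" where
  "neg_sum_pairs n w = {(i, j). 1 \<le> i \<and> i < j \<and> j \<le> int n \<and> w i + w j < 0}"

lemma finite_inversions [simp]: "finite (inversions n w)"
  by (rule finite_subset[of _ "{1..int n} \<times> {1..int n}"]) (auto simp: inversions_def)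

lemma finite_neg_sum_pairs [simp]: "finite (neg_sum_pairs n w)"
  by (rule finite_subset[of _ "{1..int n} \<times> {1..int n}"]) (auto simp: neg_sum_pairs_def)

lemma cox_length_eqI:
  fixes L :: "(int \<Rightarrow> int) \<Rightarrow> nat"
  assumes id: "id \<in> C" "L id = 0"
    and closed: "\<And>w s. w \<in> C \<Longrightarrow> s \<in> S \<Longrightarrow> w \<circ> s \<in> C"
    and step: "\<And>w s. w \<in> C \<Longrightarrow> s \<in> S \<Longrightarrow> L (w \<circ> s) \<le> L w + 1"
    and descent: "\<And>w. w \<in> C \<Longrightarrow> w \<noteq> id \<Longrightarrow> \<exists>s\<in>S. L (w \<circ> s) + 1 = L w"
    and invol: "\<And>s. s \<in> S \<Longrightarrow> s \<circ> s = id"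
    and w: "w \<in> C"
  shows "cox_length S w = L w"
proof -
  have foldr_snoc: "foldr (\<circ>) (ss @ [s]) id = foldr (\<circ>) ss id \<circ> s" for ss and s :: "int \<Rightarrow> int"
    by (induction ss) (auto simp: o_assoc)
  have ex: "\<exists>ss. length ss = L w \<and> set ss \<subseteq> S \<and> foldr (\<circ>) ss id = w"
    if "w \<in> C" for w
    using that
  proof (induction "L w" arbitrary: w rule: less_induct)
    case less
    show ?case
    proof (cases "w = id")
      case True
      then show ?thesis using id by (intro exI[of _ "[]"]) simp
    next
      case False
      then obtain s where s: "s \<in> S" "L (w \<circ> s) + 1 = L w"
        using descent less.prems by blast
      then obtain ss where ss: "length ss = L (w \<circ> s)" "set ss \<subseteq> S" "foldr (\<circ>) ss id = w \<circ> s"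
        using less.hyps[of "w \<circ> s"] closed less.prems by fastforce
      have "foldr (\<circ>) (ss @ [s]) id = w"
        unfolding foldr_snoc ss using invol[OF s(1)] by (simp add: o_assoc[symmetric])
      then show ?thesis
        using s ss by (intro exI[of _ "ss @ [s]"]) simp
    qed
  qed
  have upper: "foldr (\<circ>) ss id \<in> C \<and> L (foldr (\<circ>) ss id) \<le> length ss" if "set ss \<subseteq> S" for ss
    using that
  proof (induction ss rule: rev_induct)
    case Nil
    then show ?case using id by (simp add: id_def)
  next
    case (snoc s ss)
    from snoc.prems have s: "set ss \<subseteq> S" "s \<in> S" by simp_all
    let ?w = "foldr (\<circ>) ss id"
    have "?w \<in> C" "L ?w \<le> length ss" using snoc.IH[OF s(1)] by blast+
    moreover have "?w \<circ> s \<in> C" "L (?w \<circ> s) \<le> L ?w + 1"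
      using calculation(1) s(2) by (rule closed, rule step)
    ultimately show ?case unfolding foldr_snoc length_append
      by (simp del: o_apply add: comp_def[symmetric])
  qed
  show ?thesis
    unfolding cox_length_def
  proof (rule Least_equality)
    show "\<exists>ss. length ss = L w \<and> set ss \<subseteq> S \<and> foldr (\<circ>) ss id = w"
      by (rule ex[OF w])
  next
    fix k assume "\<exists>ss. length ss = k \<and> set ss \<subseteq> S \<and> foldr (\<circ>) ss id = w"
    then obtain ss where "length ss = k" "set ss \<subseteq> S" "foldr (\<circ>) ss id = w" by blast
    with upper[of ss] show "L w \<le> k" by blast
  qed
qed

lemma transpose_adj:
  fixes i :: int
  shows "transpose i (i + 1) k = (if k = i then i + 1 else if k = i + 1 then i else k)"
  by (simp add: transpose_def)

lemma adj_less_iff: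
  fixes i :: int
  assumes "a < b" "(a, b) \<noteq> (i, i + 1)"
  shows "transpose i (i + 1) a < transpose i (i + 1) b"
  using assms by (auto simp: transpose_adj)

lemma card_inversions_adj:
  fixes i :: int
  assumes i: "i \<in> {1..<int n}"
    and w': "\<And>k. k \<in> {1..int n} \<Longrightarrow> w' k = w (transpose i (i + 1) k)"
    and asc: "w i < w (i + 1)"
  shows "card (inversions n w') = card (inversions n w) + 1"
proof -
  let ?t = "transpose i (i + 1)"
  let ?D = "inversions n w' - {(i, i + 1)}"
  have rng: "1 \<le> ?t k \<and> ?t k \<le> int n" if "1 \<le> k" "k \<le> int n" for k
    using that i by (auto simp: transpose_adj)
  have "bij_betw (map_prod ?t ?t) ?D (inversions n w)"
  proof (rule bij_betw_byWitness[where f' = "map_prod ?t ?t"])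
    show "\<forall>a\<in>?D. map_prod ?t ?t (map_prod ?t ?t a) = a" by auto
    show "\<forall>a\<in>inversions n w. map_prod ?t ?t (map_prod ?t ?t a) = a" by auto
    show "map_prod ?t ?t ` ?D \<subseteq> inversions n w"
      using rng adj_less_iff by (auto simp: inversions_def w')
    show "map_prod ?t ?t ` inversions n w \<subseteq> ?D"
    proof
      fix p assume "p \<in> map_prod ?t ?t ` inversions n w"
      then obtain a b where ab: "p = (?t a, ?t b)" "1 \<le> a" "a < b" "b \<le> int n" "w a > w b"
        by (auto simp: inversions_def)
      then have ne: "(a, b) \<noteq> (i, i + 1)" using asc by auto
      have "(?t a, ?t b) \<noteq> (i, i + 1)"
        using ab by (auto simp: transpose_adj split: if_splits)
      then show "p \<in> ?D"
        using ab adj_less_iff[OF ab(3) ne] rng[of a] rng[of b] by (auto simp: inversions_def w')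
    qed
  qed
  then have "card ?D = card (inversions n w)" by (rule bij_betw_same_card)
  moreover have "(i, i + 1) \<in> inversions n w'"
    using i asc by (auto simp: inversions_def w' transpose_adj)
  ultimately show ?thesis
    using card.remove[OF finite_inversions, of "(i, i + 1)" n w'] by linarith
qed

lemma card_inversions_adj':
  fixes i :: int
  assumes i: "i \<in> {1..<int n}"
    and w': "\<And>k. k \<in> {1..int n} \<Longrightarrow> w' k = w (transpose i (i + 1) k)"
    and desc: "w i > w (i + 1)"
  shows "card (inversions n w') + 1 = card (inversions n w)"
proof -
  have "w k = w' (transpose i (i + 1) k)" if "k \<in> {1..int n}" for k
    using that i by (subst w') (auto simp: transpose_adj)
  moreover have "w' i < w' (i + 1)"
    using desc i by (simp add: w' transpose_adj)
  ultimately show ?thesis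
    using card_inversions_adj[of i n w w'] i by simp
qed

lemma card_neg_sum_pairs_adj:
  fixes i :: int
  assumes i: "i \<in> {1..<int n}"
    and w': "\<And>k. k \<in> {1..int n} \<Longrightarrow> w' k = w (transpose i (i + 1) k)"
  shows "card (neg_sum_pairs n w') = card (neg_sum_pairs n w)"
proof -
  let ?t = "transpose i (i + 1)"
  let ?g = "\<lambda>(a, b). if (a, b) = (i, i + 1) then (a, b) else (?t a, ?t b)"
  have rng: "1 \<le> ?t k \<and> ?t k \<le> int n" if "1 \<le> k" "k \<le> int n" for k
    using that i by (auto simp: transpose_adj)
  have gg: "?g (?g (a, b)) = (a, b)" if "a < b" for a b
    using that by (auto simp: transpose_adj)
  have ww': "w k = w' (?t k)" if "k \<in> {1..int n}" for k
    using that rng[of k] by (subst w') auto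
  have mem: "?g ` neg_sum_pairs n u \<subseteq> neg_sum_pairs n u'"
    if u: "\<And>k. k \<in> {1..int n} \<Longrightarrow> u k = u' (?t k)" for u u' :: "int \<Rightarrow> int"
  proof
    fix p assume "p \<in> ?g ` neg_sum_pairs n u"
    then obtain a b where p: "p = ?g (a, b)" and ab: "1 \<le> a" "a < b" "b \<le> int n" "u a + u b < 0"
      by (auto simp: neg_sum_pairs_def)
    have sum: "u' (?t a) + u' (?t b) < 0" using u[of a] u[of b] ab by simp
    show "p \<in> neg_sum_pairs n u'"
    proof (cases "(a, b) = (i, i + 1)")
      case True
      then show ?thesis using p ab sum by (simp add: neg_sum_pairs_def add.commute)
    next
      case False
      then have "p = (?t a, ?t b)" using p by auto
      then show ?thesis
        using ab sum rng[of a] rng[of b] adj_less_iff[OF ab(2) False]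
        by (simp add: neg_sum_pairs_def)
    qed
  qed
  have "bij_betw ?g (neg_sum_pairs n w') (neg_sum_pairs n w)"
  proof (rule bij_betw_byWitness[where f' = ?g])
    show "\<forall>p\<in>neg_sum_pairs n w'. ?g (?g p) = p" "\<forall>p\<in>neg_sum_pairs n w. ?g (?g p) = p"
      using gg by (auto simp: neg_sum_pairs_def simp del: split_paired_All)
    show "?g ` neg_sum_pairs n w' \<subseteq> neg_sum_pairs n w" "?g ` neg_sum_pairs n w \<subseteq> neg_sum_pairs n w'"
      using mem[of w'] mem[of w] w' ww' by blast+
  qed
  then show ?thesis by (rule bij_betw_same_card)
qed

lemma card_Neg_adj:
  fixes i :: int
  assumes i: "i \<in> {1..<int n}"
    and w': "\<And>k. k \<in> {1..int n} \<Longrightarrow> w' k = w (transpose i (i + 1) k)"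
  shows "card (Neg n w') = card (Neg n w)"
proof -
  let ?t = "transpose i (i + 1)"
  have rng: "1 \<le> ?t k \<and> ?t k \<le> int n" if "1 \<le> k" "k \<le> int n" for k
    using that i by (auto simp: transpose_adj)
  have "bij_betw ?t (Neg n w') (Neg n w)"
  proof (rule bij_betw_byWitness[where f' = ?t])
    show "?t ` Neg n w' \<subseteq> Neg n w"
      using rng w' by (fastforce simp: Neg_def)
    have "w' (?t k) = w k" if "k \<in> {1..int n}" for k
      using that rng[of k] by (subst w') auto
    then show "?t ` Neg n w \<subseteq> Neg n w'"
      using rng by (auto simp: Neg_def)
  qed auto
  then show ?thesis by (rule bij_betw_same_card)
qed

theorem length_S_explicit:
  assumes w: "w \<in> sym_grp n"
  shows "length_S n w = card (inversions n w)"
proof (rule cox_length_eqI[where C = "sym_grp n"])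
  show "id \<in> sym_grp n" by (simp add: sym_grp_def permutes_id)
  have "inversions n id = {}" by (auto simp: inversions_def)
  then show "card (inversions n id) = 0" by simp
next
  fix w s assume ws: "w \<in> sym_grp n" "s \<in> sym_gens n"
  then obtain i where i: "i \<in> {1..<int n}" "s = transpose i (i + 1)"
    by (auto simp: sym_gens_def)
  have "s permutes {1..int n}" using i by (simp add: permutes_swap_id)
  then show "w \<circ> s \<in> sym_grp n" using ws by (simp add: sym_grp_def permutes_compose)
  have "w i \<noteq> w (i + 1)" using sym_grp_inj[OF ws(1)] by (simp add: inj_eq)
  then show "card (inversions n (w \<circ> s)) \<le> card (inversions n w) + 1"
    using card_inversions_adj[of i n "w \<circ> s" w] card_inversions_adj'[of i n "w \<circ> s" w] i
    by (cases "w i < w (i + 1)") auto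
next
  fix w assume w: "w \<in> sym_grp n" and ne: "w \<noteq> id"
  show "\<exists>s\<in>sym_gens n. card (inversions n (w \<circ> s)) + 1 = card (inversions n w)"
  proof (cases "\<exists>i\<in>{1..<int n}. w i > w (i + 1)")
    case True
    then obtain i where "i \<in> {1..<int n}" "w i > w (i + 1)" by blast
    then show ?thesis
      using card_inversions_adj'[of i n "w \<circ> transpose i (i + 1)" w]
      by (intro bexI[of _ "transpose i (i + 1)"]) (auto simp: sym_gens_def)
  next
    case False
    have perm: "w permutes {1..int n}" using w by (simp add: sym_grp_def)
    have "w i < w (i + 1)" if "i \<in> {1..<int n}" for i
    proof -
      have "w i \<noteq> w (i + 1)" using sym_grp_inj[OF w] by (simp add: inj_eq)
      then show ?thesis using False that by force
    qed
    then have "w i = i" if "i \<in> {1..int n}" for i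
      using strict_increasing_interval_id[of n w i] permutes_in_image[OF perm] that by blast
    moreover have "w i = i" if "i \<notin> {1..int n}" for i
      using perm that by (simp add: permutes_not_in)
    ultimately have "w = id" by (metis eq_id_iff)
    with ne show ?thesis by simp
  qed
next
  show "s \<circ> s = id" if "s \<in> sym_gens n" for s
    using that by (auto simp: sym_gens_def)
qed (rule w)

lemma signed_adj_eq:
  assumes "1 \<le> i" "1 \<le> k"
  shows "(transpose i (i + 1) \<circ> transpose (- i) (- (i + 1))) k = transpose i (i + 1) (k::int)"
  using assms by (auto simp: transpose_def)

lemma signed_gens_cases:
  assumes "s \<in> signed_gens n"
  obtains "n \<ge> 1" "s = transpose 1 (- 1)"
  | i where "i \<in> {1..<int n}" "s = transpose i (i + 1) \<circ> transpose (- i) (- (i + 1))"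
  using assms unfolding signed_gens_def by (auto split: if_splits)

lemma signed_gens_in: "s \<in> signed_gens n \<Longrightarrow> s \<in> signed_grp n"
proof (erule signed_gens_cases)
  assume "n \<ge> 1" "s = transpose 1 (- 1)"
  then show "s \<in> signed_grp n"
    by (auto simp: signed_grp_def permutes_swap_id) (auto simp: transpose_def)
next
  fix i assume i: "i \<in> {1..<int n}" "s = transpose i (i + 1) \<circ> transpose (- i) (- (i + 1))"
  have "s permutes ({- int n..int n} - {0})"
    unfolding i using i(1) by (intro permutes_compose permutes_swap_id) auto
  then show "s \<in> signed_grp n"
    using i by (auto simp: signed_grp_def) (auto simp: transpose_def)
qed

lemma signed_gens_invol: "s \<in> signed_gens n \<Longrightarrow> s \<circ> s = id"
  by (erule signed_gens_cases) (auto simp: fun_eq_iff transpose_def)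

lemma length_stats_s0:
  assumes n: "n \<ge> 1" and w: "w \<in> signed_grp n"
  defines "w' \<equiv> w \<circ> transpose 1 (- 1)"
  shows "card (inversions n w') + card (neg_sum_pairs n w') =
           card (inversions n w) + card (neg_sum_pairs n w)"
    and "w 1 < 0 \<Longrightarrow> card (Neg n w') + 1 = card (Neg n w)"
    and "w 1 > 0 \<Longrightarrow> card (Neg n w') = card (Neg n w) + 1"
proof -
  have w'1: "w' 1 = - w 1" using w by (simp add: w'_def signed_grp_def)
  have w'k: "w' k = w k" if "k > 1" for k using that by (simp add: w'_def transpose_def)
  let ?A = "\<lambda>w. {(i, j) \<in> inversions n w. i = 1}" and ?A' = "\<lambda>w. {(i, j) \<in> inversions n w. i > 1}"
  let ?B = "\<lambda>w. {(i, j) \<in> neg_sum_pairs n w. i = 1}" and ?B' = "\<lambda>w. {(i, j) \<in> neg_sum_pairs n w. i > 1}"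
  have "card (inversions n w) = card (?A w) + card (?A' w)" for w
    by (subst card_Un_disjoint[symmetric])
      (auto intro!: arg_cong[where f = card] finite_subset[OF _ finite_inversions[of n w]]
        simp: inversions_def)
  moreover have "card (neg_sum_pairs n w) = card (?B w) + card (?B' w)" for w
    by (subst card_Un_disjoint[symmetric])
      (auto intro!: arg_cong[where f = card] finite_subset[OF _ finite_neg_sum_pairs[of n w]]
        simp: neg_sum_pairs_def)
  moreover have "?A w' = ?B w" "?B w' = ?A w" "?A' w' = ?A' w" "?B' w' = ?B' w"
    by (auto simp: inversions_def neg_sum_pairs_def w'1 w'k)
  ultimately show "card (inversions n w') + card (neg_sum_pairs n w') =
      card (inversions n w) + card (neg_sum_pairs n w)"
    by simp
  have fin: "finite (Neg n u)" for u
    by (rule finite_subset[of _ "{1..int n}"]) (auto simp: Neg_def)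
  show "card (Neg n w') + 1 = card (Neg n w)" if "w 1 < 0"
  proof -
    have "k \<in> Neg n w' \<longleftrightarrow> k \<in> Neg n w - {1}" for k
      using that w'1 w'k[of k] by (cases "k = 1") (auto simp: Neg_def)
    then have "Neg n w' = Neg n w - {1}" by blast
    moreover have "1 \<in> Neg n w" using that n by (simp add: Neg_def)
    ultimately show ?thesis using card.remove[OF fin[of w], of 1] by simp
  qed
  show "card (Neg n w') = card (Neg n w) + 1" if "w 1 > 0"
  proof -
    have "k \<in> Neg n w \<longleftrightarrow> k \<in> Neg n w' - {1}" for k
      using that w'1 w'k[of k] by (cases "k = 1") (auto simp: Neg_def)
    then have "Neg n w = Neg n w' - {1}" by blast
    moreover have "1 \<in> Neg n w'" using that n w'1 by (simp add: Neg_def)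
    ultimately show ?thesis using card.remove[OF fin[of w'], of 1] by simp
  qed
qed

theorem length_B_explicit:
  assumes w: "w \<in> signed_grp n"
  shows "length_B n w =
    card (Neg n w) + card (inversions n w) + card (neg_sum_pairs n w)"
proof (rule cox_length_eqI[where C = "signed_grp n"])
  show "id \<in> signed_grp n" by (simp add: signed_grp_def permutes_id)
  have "Neg n id = {}" "inversions n id = {}" "neg_sum_pairs n id = {}"
    by (auto simp: inversions_def neg_sum_pairs_def Neg_def)
  then show "card (Neg n id) + card (inversions n id) + card (neg_sum_pairs n id) = 0"
    by simp
next
  fix w s assume ws: "w \<in> signed_grp n" "s \<in> signed_gens n"
  have "s \<in> signed_grp n" using signed_gens_in ws by blast
  then show "w \<circ> s \<in> signed_grp n" using ws by (auto simp: signed_grp_def permutes_compose)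
  from ws(2) show "card (Neg n (w \<circ> s)) + card (inversions n (w \<circ> s)) + card (neg_sum_pairs n (w \<circ> s))
      \<le> card (Neg n w) + card (inversions n w) + card (neg_sum_pairs n w) + 1"
  proof (cases rule: signed_gens_cases)
    case 1
    have "w 1 \<noteq> 0"
      using ws(1) 1 permutes_in_image[of w "{- int n..int n} - {0}" 1] by (auto simp: signed_grp_def)
    then show ?thesis
      using length_stats_s0[OF 1(1) ws(1)] 1 by (cases "w 1 < 0") auto
  next
    case (2 i)
    have eq: "(w \<circ> s) k = w (transpose i (i + 1) k)" if "k \<in> {1..int n}" for k
      using signed_adj_eq[of i k] that 2 by simp
    have "w i \<noteq> w (i + 1)" using signed_grp_inj[OF ws(1)] by (simp add: inj_eq)
    then have "card (inversions n (w \<circ> s)) \<le> card (inversions n w) + 1"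
      using card_inversions_adj[of i n "w \<circ> s" w] card_inversions_adj'[of i n "w \<circ> s" w] 2(1) eq
      by (cases "w i < w (i + 1)") auto
    then show ?thesis
      using card_neg_sum_pairs_adj[of i n "w \<circ> s" w] card_Neg_adj[of i n "w \<circ> s" w] 2(1) eq
      by simp
  qed
next
  fix w assume w: "w \<in> signed_grp n" and ne: "w \<noteq> id"
  have perm: "w permutes ({- int n..int n} - {0})" and odd: "\<And>i. w (- i) = - w i"
    using w by (auto simp: signed_grp_def)
  show "\<exists>s\<in>signed_gens n. card (Neg n (w \<circ> s)) + card (inversions n (w \<circ> s)) +
      card (neg_sum_pairs n (w \<circ> s)) + 1 =
      card (Neg n w) + card (inversions n w) + card (neg_sum_pairs n w)"
  proof (cases "\<exists>i\<in>{1..<int n}. w i > w (i + 1)")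
    case True
    then obtain i where i: "i \<in> {1..<int n}" "w i > w (i + 1)" by blast
    let ?s = "transpose i (i + 1) \<circ> transpose (- i) (- (i + 1))"
    have eq: "(w \<circ> ?s) k = w (transpose i (i + 1) k)" if "k \<in> {1..int n}" for k
      using signed_adj_eq[of i k] that i by simp
    have "?s \<in> signed_gens n" using i by (auto simp: signed_gens_def)
    then show ?thesis
      using card_inversions_adj'[of i n "w \<circ> ?s" w, OF i(1) eq i(2)]
        card_neg_sum_pairs_adj[of i n "w \<circ> ?s" w, OF i(1) eq]
        card_Neg_adj[of i n "w \<circ> ?s" w, OF i(1) eq]
      by (intro bexI[of _ ?s]) linarith
  next
    case False
    have inc: "w i < w (i + 1)" if "i \<in> {1..<int n}" for i
    proof -
      have "w i \<noteq> w (i + 1)" using signed_grp_inj[OF w] by (simp add: inj_eq)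
      then show ?thesis using False that by force
    qed
    show ?thesis
    proof (cases "n \<ge> 1 \<and> w 1 < 0")
      case True
      then have "transpose 1 (- 1) \<in> signed_gens n" by (auto simp: signed_gens_def)
      then show ?thesis
        using length_stats_s0[of n w] True w by (intro bexI[of _ "transpose 1 (- 1)"]) auto
    next
      case nonneg: False
      have rng: "w i \<in> {- int n..int n} - {0}" if "i \<in> {1..int n}" for i
        using permutes_in_image[OF perm, of i] that by simp
      have pos: "k < n \<Longrightarrow> w (int k + 1) > 0" for k
      proof (induction k)
        case 0
        then have "w 1 \<noteq> 0" "\<not> w 1 < 0" using nonneg rng[of 1] by auto
        then show ?case by simp
      next
        case (Suc k)
        then show ?case using inc[of "int k + 1"] by (simp add: add.commute)
      qed
      have "w i \<in> {1..int n}" if "i \<in> {1..int n}" for i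
        using pos[of "nat (i - 1)"] rng[OF that] that by (simp add: nat_less_iff)
      then have fix_pos: "w i = i" if "i \<in> {1..int n}" for i
        using strict_increasing_interval_id[of n w i] inc that by blast
      have "w i = i" for i
      proof -
        consider "i \<in> {1..int n}" | "- i \<in> {1..int n}" | "i \<notin> {- int n..int n} - {0}"
          by fastforce
        then show ?thesis
          using fix_pos[of i] fix_pos[of "- i"] odd[of i] permutes_not_in[OF perm, of i]
          by cases auto
      qed
      then have "w = id" by auto
      with ne show ?thesis by simp
    qed
  qed
qed (use signed_gens_invol w in auto)

end

theory Submission
  imports Defs
begin

text \<open>
  Left weak order is inclusion of inversion sets, so both intervals are counted by the sums
  \<open>P T\<close> of \<open>x^\<bar>I\<bar> y^(\<bar>T\<bar> - \<bar>I\<bar>)\<close> over the inversion sets \<open>I \<subseteq> T\<close>: lower intervals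
  with \<open>(x, y) = (q, 1)\<close> and \<open>T\<close> the inversions of \<open>w\<close>, upper ones with
  \<open>(x, y) = (1, q)\<close> and \<open>T\<close> the inversions of \<open>-w\<close>. Parabolic factorization makes \<open>P\<close>
  multiplicative. Avoiding the two patterns of length 2 forces, for the last block
  \<open>{k<..m}\<close> of constant sign, all inversions between \<open>{1..k}\<close> and the block (if negative)
  or none (if positive). In the first case the block contributes the quotient of the numbers
  attached to \<open>B\<^sub>m / (B\<^sub>k \<times> S\<^bsub>m-k\<^esub>)\<close> and \<open>S\<^sub>m / (S\<^sub>k \<times> S\<^bsub>m-k\<^esub>)\<close>, which is the product of the
  \<open>x^i + y^i\<close> over the block, because \<open>P(B\<^sub>m) = P(S\<^sub>m) \<Prod>\<^bsub>i \<le> m\<^esub> (x^i + y^i)\<close>.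
\<close>

section \<open>Inversion sets\<close>

text \<open>
  The pair \<open>(i, j)\<close> with \<open>\<bar>i\<bar> < j\<close> stands for the positive root \<open>e\<^sub>j - e\<^sub>i\<close>,
  where \<open>e\<^sub>0 = 0\<close> and \<open>e\<^bsub>-i\<^esub> = - e\<^sub>i\<close>.
\<close>

definition roots :: "nat \<Rightarrow> (int \<times> int) set" where
  "roots n = {(i, j). \<bar>i\<bar> < j \<and> j \<le> int n}"

text \<open>These are the positive roots that \<open>u\<close> sends to negative ones, as
  \<open>u\<close> maps \<open>e_j - e_i\<close> to \<open>e_(u j) - e_(u i)\<close>.\<close>

definition root_inversions :: "nat \<Rightarrow> (int \<Rightarrow> int) \<Rightarrow> (int \<times> int) set" where
  "root_inversions n u = {(i, j) \<in> roots n. u j < u i}"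

text \<open>
  Up to sign, \<open>(a, b)\<close>, \<open>(b, a)\<close>, \<open>(-a, -b)\<close> and \<open>(-b, -a)\<close> are the same root.
\<close>

definition root_rep :: "int \<Rightarrow> int \<Rightarrow> int \<times> int" where
  "root_rep a b = (if \<bar>a\<bar> < \<bar>b\<bar> then if b > 0 then (a, b) else (- a, - b)
     else if a > 0 then (b, a) else (- b, - a))"

definition root_act :: "(int \<Rightarrow> int) \<Rightarrow> int \<times> int \<Rightarrow> int \<times> int" where
  "root_act h p = root_rep (h (fst p)) (h (snd p))"

lemma finite_roots [simp]: "finite (roots n)"
  by (rule finite_subset[of _ "{- int n..int n} \<times> {- int n..int n}"]) (auto simp: roots_def)

lemma root_inversions_subset: "root_inversions n u \<subseteq> roots n"
  by (auto simp: root_inversions_def)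

lemma finite_root_inversions [simp]: "finite (root_inversions n u)"
  by (rule finite_subset[OF root_inversions_subset]) simp

lemma signed_grp_uminus: "u \<in> signed_grp n \<Longrightarrow> u (- i) = - u i"
  by (simp add: signed_grp_def)

lemma signed_grp_zero: "u \<in> signed_grp n \<Longrightarrow> u 0 = 0"
  using signed_grp_uminus[of u n 0] by simp

lemma signed_grp_abs_le_iff:
  assumes "u \<in> signed_grp n"
  shows "\<bar>u i\<bar> \<le> int n \<longleftrightarrow> \<bar>i\<bar> \<le> int n"
proof -
  have "u i \<in> {- int n..int n} - {0} \<longleftrightarrow> i \<in> {- int n..int n} - {0}"
    using assms by (intro permutes_in_image) (simp add: signed_grp_def)
  moreover have "u i = 0 \<longleftrightarrow> i = 0"
    using signed_grp_inj[OF assms] signed_grp_zero[OF assms] by (metis injD)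
  ultimately show ?thesis by auto
qed

lemma signed_grp_abs_eq_iff:
  assumes "u \<in> signed_grp n"
  shows "\<bar>u i\<bar> = \<bar>u j\<bar> \<longleftrightarrow> \<bar>i\<bar> = \<bar>j\<bar>"
proof -
  have "u i = u j \<longleftrightarrow> i = j" "u i = u (- j) \<longleftrightarrow> i = - j"
    using signed_grp_inj[OF assms] by (simp_all add: inj_eq)
  then show ?thesis
    using signed_grp_uminus[OF assms] by (auto simp: abs_eq_iff)
qed

lemma signed_grp_comp:
  assumes "u \<in> signed_grp n" "v \<in> signed_grp n"
  shows "u \<circ> v \<in> signed_grp n"
proof -
  have "(u \<circ> v) permutes ({- int n..int n} - {0})"
    using assms by (intro permutes_compose) (simp_all add: signed_grp_def)
  moreover have "(u \<circ> v) (- i) = - (u \<circ> v) i" for i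
    by (simp add: signed_grp_uminus[OF assms(1)] signed_grp_uminus[OF assms(2)])
  ultimately show ?thesis unfolding signed_grp_def by blast
qed

lemma signed_grp_inv:
  assumes "u \<in> signed_grp n"
  shows "inv u \<in> signed_grp n"
proof -
  have perm: "u permutes ({- int n..int n} - {0})"
    using assms by (simp add: signed_grp_def)
  have "inv u (- i) = - inv u i" for i
    using signed_grp_uminus[OF assms, of "inv u i"] permutes_inverses[OF perm] by metis
  then show ?thesis using permutes_inv[OF perm] by (simp add: signed_grp_def)
qed

lemma signed_grp_inv_comp:
  assumes "u \<in> signed_grp n"
  shows "inv u \<circ> u = id" "u \<circ> inv u = id"
proof -
  have perm: "u permutes ({- int n..int n} - {0})"
    using assms by (simp add: signed_grp_def)
  show "inv u \<circ> u = id" "u \<circ> inv u = id"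
    using permutes_inverses[OF perm] by auto
qed

lemma signed_grp_comp_inv_cancel:
  assumes "v \<in> signed_grp n"
  shows "u \<circ> inv v \<circ> v = u" "u \<circ> v \<circ> inv v = u"
  using signed_grp_inv_comp[OF assms] by (simp_all add: comp_assoc)

text \<open>This is \<open>-u\<close>, the product of the longest element with \<open>u\<close>. It
  complements inversion sets and thereby turns upper intervals into lower ones.\<close>

lemma signed_grp_neg:
  assumes u: "u \<in> signed_grp n"
  shows "(\<lambda>i. if \<bar>i\<bar> \<le> int n then - u i else i) \<in> signed_grp n"
proof -
  let ?v = "\<lambda>i. if \<bar>i\<bar> \<le> int n then - u i else i" and ?A = "{- int n..int n} - {0}"
  have perm: "u permutes ?A" using u by (simp add: signed_grp_def)
  have "bij_betw uminus ?A ?A"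
    by (rule bij_betw_byWitness[where f' = uminus]) auto
  then have "bij_betw (uminus \<circ> u) ?A ?A"
    by (rule bij_betw_trans[OF permutes_imp_bij[OF perm]])
  moreover have "(uminus \<circ> u) i = ?v i" if "i \<in> ?A" for i
    using that by (simp add: abs_le_iff)
  ultimately have "bij_betw ?v ?A ?A"
    using bij_betw_cong[of ?A "uminus \<circ> u" ?v ?A] by blast
  moreover have "?v i = i" if "i \<notin> ?A" for i
    using that signed_grp_zero[OF u] by (cases "i = 0") (auto simp: abs_le_iff)
  ultimately have "?v permutes ?A" by (rule bij_imp_permutes)
  moreover have "?v (- i) = - ?v i" for i using signed_grp_uminus[OF u, of i] by simp
  ultimately show ?thesis by (simp add: signed_grp_def)
qed

lemma root_act_in_roots:
  assumes "h \<in> signed_grp n" "p \<in> roots n"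
  shows "root_act h p \<in> roots n"
proof -
  obtain i j where p: "p = (i, j)" "\<bar>i\<bar> < j" "j \<le> int n"
    using assms(2) by (auto simp: roots_def)
  have "\<bar>h i\<bar> \<le> int n" "\<bar>h j\<bar> \<le> int n" "\<bar>h i\<bar> \<noteq> \<bar>h j\<bar>"
    using signed_grp_abs_le_iff[OF assms(1)] signed_grp_abs_eq_iff[OF assms(1), of i j] p by auto
  then show ?thesis by (auto simp: p root_act_def root_rep_def roots_def)
qed

lemma root_rep_cases:
  assumes "\<bar>a\<bar> \<noteq> \<bar>b\<bar>"
  obtains "\<bar>a\<bar> < b" "root_rep a b = (a, b)" | "\<bar>a\<bar> < - b" "root_rep a b = (- a, - b)"
    | "\<bar>b\<bar> < a" "root_rep a b = (b, a)" | "\<bar>b\<bar> < - a" "root_rep a b = (- b, - a)"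
proof -
  consider "\<bar>a\<bar> < b" | "\<bar>a\<bar> < - b" | "\<bar>b\<bar> < a" | "\<bar>b\<bar> < - a"
    using assms by linarith
  then show thesis
    by cases (use that in \<open>auto simp: root_rep_def\<close>)
qed

lemma root_rep_uminus:
  assumes "\<bar>a\<bar> \<noteq> \<bar>b\<bar>"
  shows "root_rep (- a) (- b) = root_rep a b"
proof (cases "\<bar>a\<bar> < \<bar>b\<bar>")
  case True
  then have "b \<noteq> 0" by linarith
  with True show ?thesis by (cases b "0 :: int" rule: linorder_cases) (simp_all add: root_rep_def)
next
  case False
  then have "a \<noteq> 0" using assms by linarith
  with False show ?thesis by (cases a "0 :: int" rule: linorder_cases) (simp_all add: root_rep_def)
qed

lemma root_rep_commute: "\<bar>a\<bar> \<noteq> \<bar>b\<bar> \<Longrightarrow> root_rep b a = root_rep a b"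
  by (auto simp: root_rep_def)

text \<open>The representative chosen by the inner \<open>root_rep\<close> does not matter, because
  swapping the two entries or negating both leaves the outer one unchanged.\<close>

lemma root_act_comp:
  assumes g: "g \<in> signed_grp n" and h: "h \<in> signed_grp n" and p: "p \<in> roots n"
  shows "root_act g (root_act h p) = root_act (g \<circ> h) p"
proof -
  obtain i j where ij: "p = (i, j)" "\<bar>i\<bar> \<noteq> \<bar>j\<bar>"
    using p by (auto simp: roots_def)
  let ?a = "h i" and ?b = "h j"
  have ne: "\<bar>?a\<bar> \<noteq> \<bar>?b\<bar>" "\<bar>g ?a\<bar> \<noteq> \<bar>g ?b\<bar>"
    using signed_grp_abs_eq_iff[OF g] signed_grp_abs_eq_iff[OF h] ij by auto
  have "root_act g (root_rep ?a ?b) = root_rep (g ?a) (g ?b)"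
    using ne(1) by (cases rule: root_rep_cases)
      (simp_all add: root_act_def signed_grp_uminus[OF g] root_rep_uminus ne
        root_rep_commute[OF ne(2)] root_rep_uminus[OF ne(2)[symmetric]])
  then show ?thesis by (simp add: ij root_act_def)
qed

lemma root_act_id: "p \<in> roots n \<Longrightarrow> root_act id p = p"
  by (auto simp: root_act_def root_rep_def roots_def)

lemma bij_root_act:
  assumes "h \<in> signed_grp n"
  shows "bij_betw (root_act h) (roots n) (roots n)"
  using assms root_act_in_roots signed_grp_inv[OF assms]
  by (intro bij_betw_byWitness[where f' = "root_act (inv h)"])
    (auto simp: root_act_comp root_act_id signed_grp_inv_comp[OF assms])

lemma root_act_surj:
  assumes "h \<in> signed_grp n" "q \<in> roots n"
  obtains p where "p \<in> roots n" "q = root_act h p"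
  using bij_betw_imp_surj_on[OF bij_root_act[OF assms(1)]] assms(2) by blast

text \<open>If \<open>h\<close> does not invert \<open>p\<close>, then \<open>root_rep\<close> keeps
  the orientation of the pair of images and the verdict of \<open>d\<close> stands; otherwise it
  reverses the orientation and the verdict flips. This is the cocycle rule for inversion
  sets.\<close>

lemma root_inversions_comp:
  assumes d: "d \<in> signed_grp n" and h: "h \<in> signed_grp n" and p: "p \<in> roots n"
  shows "p \<in> root_inversions n (d \<circ> h) \<longleftrightarrow>
    (p \<in> root_inversions n h) \<noteq> (root_act h p \<in> root_inversions n d)"
proof -
  obtain i j where ij: "p = (i, j)" "\<bar>i\<bar> < j" "j \<le> int n"
    using p by (auto simp: roots_def)
  let ?a = "h i" and ?b = "h j"
  have ne: "\<bar>?a\<bar> \<noteq> \<bar>?b\<bar>" "d ?a \<noteq> d ?b"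
    using signed_grp_abs_eq_iff[OF h, of i j] signed_grp_abs_eq_iff[OF d, of ?a ?b] ij by auto
  have act: "root_act h p = root_rep ?a ?b" by (simp add: ij root_act_def)
  have "p \<in> root_inversions n (d \<circ> h) \<longleftrightarrow> d ?b < d ?a" "p \<in> root_inversions n h \<longleftrightarrow> ?b < ?a"
    using p by (auto simp: ij root_inversions_def)
  moreover have "root_act h p \<in> root_inversions n d \<longleftrightarrow> d (snd (root_rep ?a ?b)) < d (fst (root_rep ?a ?b))"
    using root_act_in_roots[OF h p] unfolding act by (simp add: root_inversions_def case_prod_beta)
  ultimately show ?thesis
    using ne(2) ne(1) by - (erule root_rep_cases, auto simp: signed_grp_uminus[OF d])
qed

text \<open>By the cocycle rule, the action of \<open>u\<close> maps the symmetric difference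
  bijectively onto the inversion set of the quotient.\<close>

lemma card_root_inversions_quotient:
  assumes u: "u \<in> signed_grp n" and w: "w \<in> signed_grp n"
  shows "card (root_inversions n (w \<circ> inv u)) =
    card ((root_inversions n w - root_inversions n u) \<union> (root_inversions n u - root_inversions n w))"
    (is "_ = card ?D")
proof -
  let ?d = "w \<circ> inv u"
  have d: "?d \<in> signed_grp n" using signed_grp_comp[OF w signed_grp_inv[OF u]] .
  have du: "?d \<circ> u = w" using signed_grp_comp_inv_cancel(1)[OF u] .
  have mem: "p \<in> ?D \<longleftrightarrow> p \<in> roots n \<and> root_act u p \<in> root_inversions n ?d" for p
    using root_inversions_comp[OF d u, of p] root_inversions_subset[of n u]
      root_inversions_subset[of n w] unfolding du by blast
  have "root_act u ` ?D = root_inversions n ?d"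
  proof
    show "root_act u ` ?D \<subseteq> root_inversions n ?d" using mem by blast
    show "root_inversions n ?d \<subseteq> root_act u ` ?D"
    proof
      fix p assume p: "p \<in> root_inversions n ?d"
      then obtain p' where "p' \<in> roots n" "p = root_act u p'"
        using bij_root_act[OF u] root_inversions_subset by (metis bij_betw_imp_surj_on imageE subsetD)
      then show "p \<in> root_act u ` ?D" using mem p by blast
    qed
  qed
  moreover have "inj_on (root_act u) ?D"
    using bij_betw_imp_inj_on[OF bij_root_act[OF u]]
    by (rule inj_on_subset) (use root_inversions_subset in blast)
  ultimately show ?thesis by (metis card_image)
qed

text \<open>Without inversions, the roots with \<open>0 < i\<close> make \<open>u\<close> increasing
  on \<open>{1..n}\<close>, and those with \<open>i = 0\<close> make it positive there.\<close>

lemma root_inversions_empty: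
  assumes u: "u \<in> signed_grp n" and "root_inversions n u = {}"
  shows "u = id"
proof -
  have inc: "u i < u j" if "\<bar>i\<bar> < j" "j \<le> int n" for i j
  proof -
    have "\<not> u j < u i" using assms(2) that by (auto simp: root_inversions_def roots_def)
    moreover have "u i \<noteq> u j" using inj_eq[OF signed_grp_inj[OF u], of i j] that by auto
    ultimately show ?thesis by simp
  qed
  have maps: "u i \<in> {1..int n}" if "i \<in> {1..int n}" for i
    using that inc[of 0 i] signed_grp_zero[OF u] signed_grp_abs_le_iff[OF u, of i] by auto
  have pos: "u i = i" if "i \<in> {1..int n}" for i
    using strict_increasing_interval_id[of n u i] maps inc that by simp
  have "u i = i" for i
  proof -
    consider "i \<in> {1..int n}" | "- i \<in> {1..int n}" | "i \<notin> {- int n..int n} - {0}"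
      by fastforce
    then show ?thesis
      using pos[of i] pos[of "- i"] signed_grp_uminus[OF u, of i] u
        permutes_not_in[of u "{- int n..int n} - {0}" i]
      by cases (auto simp: signed_grp_def)
  qed
  then show ?thesis by auto
qed

lemma inj_on_root_inversions: "inj_on (root_inversions n) (signed_grp n)"
proof (rule inj_onI)
  fix u v assume uv: "u \<in> signed_grp n" "v \<in> signed_grp n" "root_inversions n u = root_inversions n v"
  then have "card (root_inversions n (u \<circ> inv v)) = 0"
    using card_root_inversions_quotient[of v n u] by simp
  then have "u \<circ> inv v = id"
    using root_inversions_empty[of "u \<circ> inv v" n] uv signed_grp_comp signed_grp_inv by simp
  then show "u = v" using signed_grp_comp_inv_cancel(1)[OF uv(2), of u] by simp
qed

text \<open>The roots with \<open>i = 0\<close>, \<open>0 < i\<close> and \<open>i < 0\<close>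
  account for \<open>Neg\<close>, \<open>inversions\<close> and \<open>neg_sum_pairs\<close>; in the
  last case oddness turns \<open>u j < u i\<close> into a negative sum.\<close>

lemma length_B_root_inversions:
  assumes u: "u \<in> signed_grp n"
  shows "length_B n u = card (root_inversions n u)"
proof -
  let ?f = "\<lambda>(i::int, j::int). (- i, j)" and ?g = "\<lambda>j::int. (0::int, j)"
  have "root_inversions n u = ?g ` Neg n u \<union> inversions n u \<union> ?f ` neg_sum_pairs n u"
  proof (intro set_eqI)
    fix p :: "int \<times> int"
    obtain i j where p: "p = (i, j)" by fastforce
    have "(i, j) \<in> ?f ` neg_sum_pairs n u \<longleftrightarrow> (- i, j) \<in> neg_sum_pairs n u"
      by force
    then show "p \<in> root_inversions n u \<longleftrightarrow> p \<in> ?g ` Neg n u \<union> inversions n u \<union> ?f ` neg_sum_pairs n u"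
      using signed_grp_zero[OF u] signed_grp_uminus[OF u, of i]
      by (cases i "0::int" rule: linorder_cases)
        (auto simp: p root_inversions_def roots_def Neg_def inversions_def neg_sum_pairs_def)
  qed
  moreover have "card (?g ` Neg n u \<union> inversions n u \<union> ?f ` neg_sum_pairs n u) =
      card (?g ` Neg n u) + card (inversions n u) + card (?f ` neg_sum_pairs n u)"
  proof -
    have "finite (Neg n u)" by (rule finite_subset[of _ "{1..int n}"]) (auto simp: Neg_def)
    moreover have "?g ` Neg n u \<inter> inversions n u = {}"
      "(?g ` Neg n u \<union> inversions n u) \<inter> ?f ` neg_sum_pairs n u = {}"
      by (auto simp: Neg_def inversions_def neg_sum_pairs_def)
    ultimately show ?thesis by (simp add: card_Un_disjoint)
  qed
  moreover have "card (?g ` Neg n u) = card (Neg n u)" "card (?f ` neg_sum_pairs n u) = card (neg_sum_pairs n u)"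
    by (auto intro!: card_image inj_onI)
  ultimately show ?thesis using length_B_explicit[OF u] by simp
qed

text \<open>With \<open>U\<close> and \<open>W\<close> the two inversion sets, the lengths of
  \<open>u\<close> and of the quotient add up to the length of \<open>w\<close> plus twice the size
  of \<open>U - W\<close>.\<close>

lemma left_weak_le_B_iff:
  assumes u: "u \<in> signed_grp n" and w: "w \<in> signed_grp n"
  shows "left_weak_le (length_B n) u w \<longleftrightarrow> root_inversions n u \<subseteq> root_inversions n w"
proof -
  let ?U = "root_inversions n u" and ?W = "root_inversions n w"
  have "length_B n (w \<circ> inv u) = card ((?W - ?U) \<union> (?U - ?W))"
    using length_B_root_inversions[OF signed_grp_comp[OF w signed_grp_inv[OF u]]]
      card_root_inversions_quotient[OF u w] by simp
  also have "\<dots> = card (?W - ?U) + card (?U - ?W)"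
    by (rule card_Un_disjoint) auto
  finally have q: "length_B n (w \<circ> inv u) = card (?W - ?U) + card (?U - ?W)" .
  have "card ?W = card (?W \<inter> ?U) + card (?W - ?U)" "card ?U = card (?U \<inter> ?W) + card (?U - ?W)"
    by (simp_all add: card_Int_Diff)
  then have "left_weak_le (length_B n) u w \<longleftrightarrow> card (?U - ?W) = 0"
    unfolding left_weak_le_def length_B_root_inversions[OF u] length_B_root_inversions[OF w] q
    by (simp add: Int_commute)
  then show ?thesis by simp
qed

section \<open>Parabolic factorization\<close>

text \<open>The ranks of the \<open>2n + 1\<close> values of \<open>f\<close> are symmetric about
  the rank of \<open>f 0\<close>, so shifted ranks form a signed permutation. This builds group
  elements with prescribed inversions.\<close>

lemma standardization_exists:
  assumes odd: "\<And>i. f (- i) = - f i" and inj: "inj_on f {- int n..int n}"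
  obtains h where "h \<in> signed_grp n"
    "\<And>i j. \<bar>i\<bar> \<le> int n \<Longrightarrow> \<bar>j\<bar> \<le> int n \<Longrightarrow> h i < h j \<longleftrightarrow> (f i :: int) < f j"
proof -
  let ?A = "{- int n..int n}" and ?B = "{- int n..int n} - {0}"
  let ?r = "\<lambda>i. card {j \<in> ?A. f j \<le> f i}"
  \<comment> \<open>The rank at \<open>0\<close> is \<open>n + 1\<close>, which the shift sends to
    \<open>0\<close>.\<close>
  define h where "h = (\<lambda>i. if i \<in> ?A then int (?r i) - int n - 1 else i)"
  have less_iff: "h i < h j \<longleftrightarrow> f i < f j" if "i \<in> ?A" "j \<in> ?A" for i j
    using that card_rank_less[of ?A i j f] by (simp add: h_def)
  \<comment> \<open>Negation turns the indices with values at most \<open>f (- i)\<close> into those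
    with values at least \<open>f i\<close>. Together with those of values at most
    \<open>f i\<close> they fill all \<open>2n + 1\<close> places and overlap only in
    \<open>i\<close>.\<close>
  have r: "?r i + ?r (- i) = 2 * n + 2" if i: "i \<in> ?A" for i
  proof -
    have "{j \<in> ?A. f j \<le> f (- i)} = uminus ` {j \<in> ?A. f i \<le> f j}"
    proof (intro set_eqI iffI)
      fix j assume "j \<in> {j \<in> ?A. f j \<le> f (- i)}"
      then have "- j \<in> {j \<in> ?A. f i \<le> f j}" using odd[of i] odd[of j] by simp
      then show "j \<in> uminus ` {j \<in> ?A. f i \<le> f j}" by (rule rev_image_eqI) simp
    next
      fix j assume "j \<in> uminus ` {j \<in> ?A. f i \<le> f j}"
      then obtain k where "k \<in> ?A" "f i \<le> f k" "j = - k" by blast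
      then show "j \<in> {j \<in> ?A. f j \<le> f (- i)}" using odd[of i] odd[of k] by simp
    qed
    then have *: "?r (- i) = card {j \<in> ?A. f i \<le> f j}" by (simp add: card_image)
    have fin: "finite {j \<in> ?A. P j}" for P
      by (rule finite_subset[of _ ?A]) auto
    have un: "{j \<in> ?A. f j \<le> f i} \<union> {j \<in> ?A. f i \<le> f j} = ?A" by auto
    have int: "{j \<in> ?A. f j \<le> f i} \<inter> {j \<in> ?A. f i \<le> f j} = {i}"
    proof (intro equalityI subsetI)
      fix j assume "j \<in> {j \<in> ?A. f j \<le> f i} \<inter> {j \<in> ?A. f i \<le> f j}"
      then have "j \<in> ?A" "f j = f i" by simp_all
      then show "j \<in> {i}" using inj_onD[OF inj, of j i] i by blast
    qed (use i in simp)
    have "?r i + card {j \<in> ?A. f i \<le> f j} = card ?A + card {i}"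
      using card_Un_Int[OF fin[of "\<lambda>j. f j \<le> f i"] fin[of "\<lambda>j. f i \<le> f j"]]
      unfolding un int by simp
    with * show ?thesis by simp
  qed
  have h_odd: "h (- i) = - h i" for i
  proof (cases "i \<in> ?A")
    case True
    then have "int (?r i) + int (?r (- i)) = 2 * int n + 2" using r[OF True] by linarith
    then show ?thesis using True by (auto simp: h_def)
  next
    case False
    then have "- i \<notin> ?A" by auto
    with False show ?thesis unfolding h_def by (simp only: if_False)
  qed
  have h0: "h 0 = 0" using h_odd[of 0] by simp
  have hinj: "inj_on h ?A"
  proof (rule inj_onI)
    fix i j assume ij: "i \<in> ?A" "j \<in> ?A" "h i = h j"
    then have "f i = f j" using less_iff[OF ij(1,2)] less_iff[OF ij(2,1)] by simp
    then show "i = j" using inj ij by (auto dest: inj_onD)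
  qed
  have "h ` ?B \<subseteq> ?B"
  proof
    fix k assume "k \<in> h ` ?B"
    then obtain i where i: "i \<in> ?A" "i \<noteq> 0" "k = h i" by blast
    then have "- i \<in> ?A" by auto
    have low: "- int n \<le> h j" if "j \<in> ?A" for j
    proof -
      have "j \<in> {l \<in> ?A. f l \<le> f j}" using that by simp
      then have "?r j > 0" by (subst card_gt_0_iff) (auto intro: rev_finite_subset[of ?A])
      then show ?thesis using that by (simp add: h_def)
    qed
    have "h i \<noteq> 0" using hinj i h0 by (metis atLeastAtMost_iff inj_onD neg_le_0_iff_le of_nat_0_le_iff)
    then show "k \<in> ?B" using i low[OF i(1)] low[OF \<open>- i \<in> ?A\<close>] h_odd[of i] by auto
  qed
  moreover have "inj_on h ?B" using hinj by (rule inj_on_subset) auto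
  ultimately have "bij_betw h ?B ?B"
    by (simp add: bij_betw_def endo_inj_surj)
  then have "h permutes ?B"
    using h0 by (intro bij_imp_permutes) (auto simp: h_def)
  then have "h \<in> signed_grp n" using h_odd by (simp add: signed_grp_def)
  then show thesis using less_iff that[of h] by (simp add: abs_le_iff)
qed

text \<open>
  The level sets of an odd monotone function are the blocks of a standard parabolic subgroup.
\<close>

definition odd_mono :: "(int \<Rightarrow> int) \<Rightarrow> bool" where
  "odd_mono b \<longleftrightarrow> mono b \<and> (\<forall>i. b (- i) = - b i)"

lemma odd_mono_zero: "odd_mono b \<Longrightarrow> b 0 = 0"
  unfolding odd_mono_def by (metis add.inverse_neutral add.inverse_inverse neg_equal_zero)

lemma odd_monoD:
  assumes "odd_mono b"
  shows "b (- i) = - b i" "i \<le> j \<Longrightarrow> b i \<le> b j"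
  using assms by (auto simp: odd_mono_def mono_def)

text \<open>Sorting the indices first by \<open>b\<close> and only then by \<open>u\<close> keeps
  the inversions of \<open>u\<close> inside the level sets and removes all others. The result
  \<open>h\<close> is the parabolic factor of \<open>u\<close>.\<close>

lemma parabolic_part_exists:
  assumes b: "odd_mono b" and u: "u \<in> signed_grp n"
  obtains h where "h \<in> signed_grp n"
    "root_inversions n h = {p \<in> root_inversions n u. b (fst p) = b (snd p)}"
proof -
  \<comment> \<open>Two values of \<open>u\<close> on \<open>{-n..n}\<close> differ by at most
    \<open>2n\<close>, so the weight \<open>2n + 1\<close> makes \<open>f\<close>
    lexicographic.\<close>
  define M where "M = 2 * int n + 1"
  define f where "f = (\<lambda>i. M * b i + u i)"
  have odd: "f (- i) = - f i" for i
    using odd_monoD(1)[OF b, of i] signed_grp_uminus[OF u, of i] by (simp add: f_def)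
  have lex: "f i < f j" if "\<bar>i\<bar> \<le> int n" "\<bar>j\<bar> \<le> int n" "b i < b j" for i j
  proof -
    have "\<bar>u i\<bar> \<le> int n" "\<bar>u j\<bar> \<le> int n" using that signed_grp_abs_le_iff[OF u] by auto
    moreover have "M * b i + M \<le> M * b j"
      using that mult_left_mono[of "b i + 1" "b j" M] by (simp add: M_def algebra_simps)
    ultimately show ?thesis by (simp add: f_def M_def)
  qed
  have "inj_on f {- int n..int n}"
  proof (rule inj_onI)
    fix i j assume ij: "i \<in> {- int n..int n}" "j \<in> {- int n..int n}" "f i = f j"
    then have "\<bar>i\<bar> \<le> int n" "\<bar>j\<bar> \<le> int n" by auto
    then have "b i = b j" using lex[of i j] lex[of j i] ij(3) by (cases "b i" "b j" rule: linorder_cases) auto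
    then have "u i = u j" using ij by (simp add: f_def)
    then show "i = j" using signed_grp_inj[OF u] by (simp add: inj_eq)
  qed
  then obtain h where h: "h \<in> signed_grp n"
    and less: "\<And>i j. \<bar>i\<bar> \<le> int n \<Longrightarrow> \<bar>j\<bar> \<le> int n \<Longrightarrow> h i < h j \<longleftrightarrow> f i < f j"
    using standardization_exists[of f n] odd by blast
  have "(i, j) \<in> root_inversions n h \<longleftrightarrow> (i, j) \<in> root_inversions n u \<and> b i = b j"
    if "\<bar>i\<bar> < j" "j \<le> int n" for i j
  proof -
    have "b i \<le> b j" using that odd_monoD(2)[OF b] by simp
    moreover have "h j < h i \<longleftrightarrow> f j < f i" using less that by simp
    ultimately have "h j < h i \<longleftrightarrow> u j < u i \<and> b i = b j"
      using lex[of i j] that by (cases "b i = b j") (auto simp: f_def)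
    then show ?thesis using that by (auto simp: root_inversions_def roots_def)
  qed
  then have "root_inversions n h = {p \<in> root_inversions n u. b (fst p) = b (snd p)}"
    using root_inversions_subset[of n h] root_inversions_subset[of n u]
    by (fastforce simp: roots_def)
  then show thesis using that h by blast
qed

text \<open>Up to sign, every pair is a root of the encoding except \<open>(- j, j)\<close>, where
  \<open>2 e_j\<close> is a multiple of the root recorded as \<open>(0, j)\<close>.\<close>

lemma inverted_pair_cases:
  assumes u: "u \<in> signed_grp n" and ij: "i < j" "\<bar>i\<bar> \<le> int n" "\<bar>j\<bar> \<le> int n" "u j < u i"
  obtains "(i, j) \<in> root_inversions n u" | "(- j, - i) \<in> root_inversions n u"
    | "i = - j" "(0, j) \<in> root_inversions n u"
proof -
  consider "\<bar>i\<bar> < j" | "\<bar>j\<bar> < - i" | "i = - j" "j > 0" using ij(1) by linarith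
  then show thesis
  proof cases
    case 1
    then show ?thesis using that(1) ij by (simp add: root_inversions_def roots_def)
  next
    case 2
    then show ?thesis
      using that(2) ij by (simp add: root_inversions_def roots_def signed_grp_uminus[OF u])
  next
    case 3
    then have "u j < 0" using ij(4) signed_grp_uminus[OF u, of j] by simp
    then show ?thesis
      using that(3) 3 ij by (simp add: root_inversions_def roots_def signed_grp_zero[OF u])
  qed
qed

text \<open>
  If \<open>h\<close> only inverts pairs inside the level sets of \<open>b\<close>, then the images of the sublevel
  sets of \<open>b\<close> are initial segments again, of the same size.
\<close>

lemma parabolic_preserves_blocks:
  assumes b: "odd_mono b" and h: "h \<in> signed_grp n"
    and blocks: "\<And>p. p \<in> root_inversions n h \<Longrightarrow> b (fst p) = b (snd p)"
  shows "\<bar>i\<bar> \<le> int n \<Longrightarrow> b (h i) = b i"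
proof -
  let ?A = "{- int n..int n}"
  have inv: "b i = b j" if "i < j" "\<bar>i\<bar> \<le> int n" "\<bar>j\<bar> \<le> int n" "h j < h i" for i j
    using h that
  proof (cases rule: inverted_pair_cases)
    case 3
    then have "b j = 0" using blocks[of "(0, j)"] odd_mono_zero[OF b] by simp
    then show ?thesis using 3 odd_monoD(1)[OF b, of j] by simp
  qed (use blocks[of "(i, j)"] blocks[of "(- j, - i)"] odd_monoD(1)[OF b] in auto)
  have mem: "h i \<in> ?A \<longleftrightarrow> i \<in> ?A" for i
    using signed_grp_abs_le_iff[OF h, of i] by (auto simp: abs_le_iff)
  have sub: "h ` {i \<in> ?A. b i \<le> c} = {i \<in> ?A. b i \<le> c}" (is "h ` ?D = ?D") for c
  proof -
    have card: "card (h ` ?D) = card ?D"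
      using signed_grp_inj[OF h] by (intro card_image) (auto intro: inj_on_subset)
    \<comment> \<open>If the preimage \<open>i\<close> of \<open>y\<close> had a level above
      \<open>c\<close>, then \<open>j < i\<close> would be an inverted pair with different
      levels.\<close>
    have down: "y \<in> h ` ?D" if xy: "x \<in> h ` ?D" "y \<in> ?A" "y < x" for x y
    proof -
      obtain j where j: "j \<in> ?D" "x = h j" using xy(1) by blast
      obtain i where i: "y = h i"
        using signed_grp_inv_comp(2)[OF h] by (metis comp_apply id_apply)
      then have iA: "i \<in> ?A" using mem that(2) by blast
      have "b i \<le> c"
      proof (rule ccontr)
        assume "\<not> b i \<le> c"
        then have "b j < b i" using j by simp
        then have "j < i" using odd_monoD(2)[OF b, of i j] by linarith
        then show False
          using inv[of j i] \<open>b j < b i\<close> i j iA that(3) by (auto simp: abs_le_iff)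
      qed
      then show ?thesis using i iA by blast
    qed
    have hD: "h ` ?D \<subseteq> ?A" using mem by blast
    \<comment> \<open>Both sets are initial segments of \<open>{-n..n}\<close>, hence comparable;
      their sizes agree, so they are equal.\<close>
    have "h ` ?D \<subseteq> ?D \<or> ?D \<subseteq> h ` ?D"
    proof (rule ccontr)
      assume "\<not> ?thesis"
      then obtain x y where xy: "x \<in> h ` ?D" "x \<notin> ?D" "y \<in> ?D" "y \<notin> h ` ?D" by blast
      then have "b y < b x" using hD by fastforce
      then have "y < x" using odd_monoD(2)[OF b, of x y] by linarith
      then show False using down[of x y] xy by blast
    qed
    moreover have "finite ?D" by (rule finite_subset[of _ ?A]) auto
    ultimately show ?thesis
      using card card_subset_eq[of ?D "h ` ?D"] card_subset_eq[of "h ` ?D" ?D] by fastforce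
  qed
  assume i: "\<bar>i\<bar> \<le> int n"
  then have iA: "i \<in> ?A" by (simp add: abs_le_iff)
  have "b (h i) \<le> c \<longleftrightarrow> b i \<le> c" for c
  proof -
    have "b i \<le> c \<longleftrightarrow> h i \<in> h ` {i \<in> ?A. b i \<le> c}"
      using iA inj_image_mem_iff[OF signed_grp_inj[OF h]] by simp
    also have "\<dots> \<longleftrightarrow> h i \<in> {i \<in> ?A. b i \<le> c}" by (simp only: sub)
    also have "\<dots> \<longleftrightarrow> b (h i) \<le> c" using mem[of i] iA by blast
    finally show ?thesis ..
  qed
  from this[of "b i"] this[of "b (h i)"] show "b (h i) = b i" by simp
qed

text \<open>Homogeneity in \<open>x\<close> and \<open>y\<close> lets one argument serve lower and
  upper intervals. For finite \<open>T\<close> the subtraction does not truncate.\<close>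

definition inv_poly :: "int poly \<Rightarrow> int poly \<Rightarrow> nat \<Rightarrow> (int \<times> int) set \<Rightarrow> int poly" where
  "inv_poly x y n T = (\<Sum>u\<in>{u \<in> signed_grp n. root_inversions n u \<subseteq> T}.
     x ^ card (root_inversions n u) * y ^ (card T - card (root_inversions n u)))"

text \<open>
  Each \<open>u\<close> factors uniquely as \<open>d \<circ> h\<close> with \<open>h\<close> in the parabolic subgroup and \<open>d\<close> increasing on
  its blocks; \<open>h\<close> permutes \<open>T'\<close> because it preserves the blocks.
\<close>

lemma inv_poly_parabolic:
  assumes b: "odd_mono b"
    and T: "T \<subseteq> roots n" "\<And>i j. (i, j) \<in> T \<Longrightarrow> b i = b j"
    and tau: "\<And>c d. \<tau> c d \<longleftrightarrow> \<tau> d c" "\<And>c d. \<tau> c d \<longleftrightarrow> \<tau> (- c) (- d)" "\<And>c. \<not> \<tau> c c"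
    and T': "T' = {p \<in> roots n. \<tau> (b (fst p)) (b (snd p))}"
  shows "inv_poly x y n (T \<union> T') = inv_poly x y n T * inv_poly x y n T'"
proof -
  let ?I = "root_inversions n" and ?G = "signed_grp n"
  let ?X = "\<lambda>T. {u \<in> ?G. ?I u \<subseteq> T}"
  have fin: "finite T" "finite T'" using T(1) T' by (auto intro: finite_subset[of _ "roots n"])
  have disj: "T \<inter> T' = {}" using T(2) T' tau(3) by fastforce
  \<comment> \<open>Membership in \<open>T'\<close> depends only on the levels, which
    \<open>h\<close> preserves; the symmetries of \<open>\<tau>\<close> absorb the choice made by
    \<open>root_rep\<close>.\<close>
  have act: "root_act h p \<in> T' \<longleftrightarrow> p \<in> T'" if h: "h \<in> ?X T" and p: "p \<in> roots n" for h p
  proof -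
    obtain i j where ij: "p = (i, j)" "\<bar>i\<bar> < j" "j \<le> int n"
      using p by (auto simp: roots_def)
    have "b (h k) = b k" if "\<bar>k\<bar> \<le> int n" for k
      by (rule parabolic_preserves_blocks[OF b _ _ that, of h]) (use h T(2) in auto)
    then have bij: "b (h i) = b i" "b (h j) = b j" using ij by auto
    have ne: "\<bar>h i\<bar> \<noteq> \<bar>h j\<bar>" using signed_grp_abs_eq_iff[of h n i j] h ij by auto
    then have "\<tau> (b (fst (root_rep (h i) (h j)))) (b (snd (root_rep (h i) (h j)))) \<longleftrightarrow> \<tau> (b i) (b j)"
      by (cases rule: root_rep_cases)
        (use tau(1)[of "b i" "b j"] tau(2)[of "b i" "b j"] tau(1)[of "- b i" "- b j"] in
          \<open>simp_all add: bij odd_monoD(1)[OF b]\<close>)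
    then show ?thesis using root_act_in_roots[of h n p] h p by (simp add: T' ij root_act_def)
  qed
  \<comment> \<open>The inversions of \<open>h\<close> lie in \<open>T\<close> and those pulled back
    from \<open>d\<close> lie in \<open>T'\<close>, so the exclusive or of the cocycle rule becomes
    a disjoint union.\<close>
  have I_comp: "?I (d \<circ> h) = ?I h \<union> {p \<in> T'. root_act h p \<in> ?I d}"
    if h: "h \<in> ?X T" and d: "d \<in> ?X T'" for h d
  proof (intro set_eqI)
    fix p
    show "p \<in> ?I (d \<circ> h) \<longleftrightarrow> p \<in> ?I h \<union> {p \<in> T'. root_act h p \<in> ?I d}"
    proof (cases "p \<in> roots n")
      case True
      then show ?thesis
        using root_inversions_comp[of d n h p] act[OF h True] h d disj by blast
    qed (use root_inversions_subset T' in blast)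
  qed
  have card_moved: "card {p \<in> T'. root_act h p \<in> ?I d} = card (?I d)"
    if h: "h \<in> ?X T" and d: "d \<in> ?X T'" for h d
  proof -
    have "root_act h ` {p \<in> T'. root_act h p \<in> ?I d} = ?I d"
    proof (intro equalityI subsetI)
      fix q assume q: "q \<in> ?I d"
      then have "q \<in> roots n" using root_inversions_subset by blast
      then obtain p where p: "p \<in> roots n" "q = root_act h p"
        using root_act_surj[of h n q] h by blast
      then have "p \<in> T'" using act[OF h p(1)] q d by blast
      then show "q \<in> root_act h ` {p \<in> T'. root_act h p \<in> ?I d}" using p q by blast
    qed blast
    moreover have "inj_on (root_act h) (roots n)"
      using bij_betw_imp_inj_on[OF bij_root_act[of h n]] h by blast
    then have "inj_on (root_act h) {p \<in> T'. root_act h p \<in> ?I d}"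
      by (rule inj_on_subset) (use T' in blast)
    ultimately show ?thesis by (metis card_image)
  qed
  have bij: "bij_betw (\<lambda>(h, d). d \<circ> h) (?X T \<times> ?X T') (?X (T \<union> T'))"
  proof (rule bij_betw_imageI)
    show "inj_on (\<lambda>(h, d). d \<circ> h) (?X T \<times> ?X T')"
    proof (rule inj_onI, clarify)
      fix h d h' d'
      assume h: "h \<in> ?G" "?I h \<subseteq> T" and d: "d \<in> ?G" "?I d \<subseteq> T'"
        and h': "h' \<in> ?G" "?I h' \<subseteq> T" and d': "d' \<in> ?G" "?I d' \<subseteq> T'" and eq: "d \<circ> h = d' \<circ> h'"
      \<comment> \<open>Intersecting with \<open>T\<close> recovers the inversion set of
        \<open>h\<close>, hence \<open>h\<close> itself, and then \<open>d\<close>.\<close>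
      have "?I h = ?I (d \<circ> h) \<inter> T" using I_comp[of h d] h d disj by blast
      moreover have "?I h' = ?I (d' \<circ> h') \<inter> T" using I_comp[of h' d'] h' d' disj by blast
      ultimately have "?I h = ?I h'" by (simp only: eq)
      then have hh: "h = h'" by (rule inj_onD[OF inj_on_root_inversions _ h(1) h'(1)])
      have "d = d \<circ> h \<circ> inv h" by (simp only: signed_grp_comp_inv_cancel(2)[OF h(1)])
      also have "\<dots> = d' \<circ> h \<circ> inv h" unfolding eq unfolding hh ..
      also have "\<dots> = d'" by (simp only: signed_grp_comp_inv_cancel(2)[OF h(1)])
      finally show "h = h' \<and> d = d'" using hh by blast
    qed
    show "(\<lambda>(h, d). d \<circ> h) ` (?X T \<times> ?X T') = ?X (T \<union> T')"
    proof (intro equalityI subsetI)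
      fix u assume "u \<in> (\<lambda>(h, d). d \<circ> h) ` (?X T \<times> ?X T')"
      then obtain h d where hd: "h \<in> ?X T" "d \<in> ?X T'" "u = d \<circ> h" by auto
      then show "u \<in> ?X (T \<union> T')" using I_comp[OF hd(1,2)] signed_grp_comp[of d n h] by auto
    next
      fix u assume u: "u \<in> ?X (T \<union> T')"
      then obtain h where h: "h \<in> ?G" "?I h = {p \<in> ?I u. b (fst p) = b (snd p)}"
        using parabolic_part_exists[OF b, of u n] by blast
      \<comment> \<open>All inversions of \<open>u\<close> lie in \<open>T \<union> T'\<close>;
        pairs in \<open>T\<close> have equal levels, and irreflexivity of \<open>\<tau>\<close>
        gives pairs in \<open>T'\<close> different ones.\<close>
      have Ih: "?I h = ?I u \<inter> T" using h(2) u T(2) T' tau(3) by fastforce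
      define d where "d = u \<circ> inv h"
      have dh: "d \<circ> h = u" using signed_grp_comp_inv_cancel(1)[OF h(1)] by (simp add: d_def)
      have d: "d \<in> ?G" using signed_grp_comp signed_grp_inv[OF h(1)] u by (simp add: d_def)
      have "?I d \<subseteq> T'"
      proof
        fix q assume q: "q \<in> ?I d"
        then have "q \<in> roots n" using root_inversions_subset by blast
        then obtain p where p: "p \<in> roots n" "q = root_act h p"
          using root_act_surj[OF h(1)] by blast
        then have "(p \<in> ?I u) \<noteq> (p \<in> ?I h)" using root_inversions_comp[OF d h(1) p(1)] q dh by blast
        then have "p \<in> T'" using Ih u by blast
        then show "q \<in> T'" using act[of h p] h(1) Ih p by simp
      qed
      then show "u \<in> (\<lambda>(h, d). d \<circ> h) ` (?X T \<times> ?X T')"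
        using d h(1) Ih dh by (intro image_eqI[of _ _ "(h, d)"]) auto
    qed
  qed
  let ?w = "\<lambda>T u. x ^ card (?I u) * y ^ (card T - card (?I u))"
  have weight: "?w (T \<union> T') (d \<circ> h) = ?w T h * ?w T' d" if "h \<in> ?X T" "d \<in> ?X T'" for h d
  proof -
    have "?I h \<inter> {p \<in> T'. root_act h p \<in> ?I d} = {}" using that disj by blast
    then have "card (?I (d \<circ> h)) = card (?I h) + card (?I d)"
      unfolding I_comp[OF that] using card_moved[OF that] fin(2) by (simp add: card_Un_disjoint)
    moreover have "card (?I h) \<le> card T" "card (?I d) \<le> card T'" "card (T \<union> T') = card T + card T'"
      using that fin disj by (auto intro: card_mono simp: card_Un_disjoint)
    ultimately show ?thesis by (simp add: power_add[symmetric] algebra_simps)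
  qed
  have "inv_poly x y n (T \<union> T') = (\<Sum>(h, d)\<in>?X T \<times> ?X T'. ?w (T \<union> T') (d \<circ> h))"
    unfolding inv_poly_def
    by (subst sum.reindex_bij_betw[OF bij, symmetric]) (simp add: case_prod_beta)
  also have "\<dots> = (\<Sum>(h, d)\<in>?X T \<times> ?X T'. ?w T h * ?w T' d)"
    by (rule sum.cong) (use weight in auto)
  also have "\<dots> = inv_poly x y n T * inv_poly x y n T'"
    unfolding inv_poly_def sum_product sum.cartesian_product ..
  finally show ?thesis .
qed

section \<open>Factorizations along blocks of indices\<close>

definition pos_roots :: "nat \<Rightarrow> (int \<times> int) set" where
  "pos_roots m = {(i, j) \<in> roots m. 0 < i}"

lemma roots_mono: "k \<le> m \<Longrightarrow> roots k \<subseteq> roots m"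
  by (auto simp: roots_def)

text \<open>The map \<open>b\<close> collapses \<open>{-k..k}\<close> to \<open>0\<close> and keeps
  all other indices apart. Since those levels are singletons, \<open>\<tau>\<close> can be the
  closure of an arbitrary \<open>Y\<close> under swapping and negation.\<close>

lemma inv_poly_product:
  assumes "k \<le> n" and T: "T \<subseteq> roots k" and Y: "Y \<subseteq> {(i, j) \<in> roots n. int k < i}"
  shows "inv_poly x y n (T \<union> Y) = inv_poly x y n T * inv_poly x y n Y"
proof -
  define b where "b = (\<lambda>i. if \<bar>i\<bar> \<le> int k then 0 else i)"
  define \<tau> where "\<tau> c d \<longleftrightarrow> (c, d) \<in> Y \<or> (d, c) \<in> Y \<or> (- c, - d) \<in> Y \<or> (- d, - c) \<in> Y" for c d
  have Y_D: "int k < c \<and> c < d \<and> d \<le> int n" if "(c, d) \<in> Y" for c d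
    using that Y by (auto simp: roots_def)
  show ?thesis
  proof (rule inv_poly_parabolic[where b = b and \<tau> = \<tau>])
    show "odd_mono b" by (auto simp: odd_mono_def mono_def b_def)
    show "T \<subseteq> roots n" using T roots_mono[OF assms(1)] by blast
    show "b i = b j" if "(i, j) \<in> T" for i j
      using that T by (auto simp: roots_def b_def)
    show "\<tau> c d \<longleftrightarrow> \<tau> d c" for c d by (auto simp: \<tau>_def)
    show "\<tau> c d \<longleftrightarrow> \<tau> (- c) (- d)" for c d by (auto simp: \<tau>_def)
    show "\<not> \<tau> c c" for c using Y_D[of c c] Y_D[of "- c" "- c"] by (auto simp: \<tau>_def)
    have "(i, j) \<in> Y \<longleftrightarrow> \<tau> (b i) (b j)" if ij: "(i, j) \<in> roots n" for i j
    proof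
      assume "(i, j) \<in> Y"
      then show "\<tau> (b i) (b j)" using Y_D[of i j] by (simp add: \<tau>_def b_def)
    next
      assume tau: "\<tau> (b i) (b j)"
      have "\<bar>i\<bar> < j" using ij by (simp add: roots_def)
      then have "\<bar>b i\<bar> \<le> \<bar>b j\<bar>" "0 \<le> b j" by (auto simp: b_def)
      then have "(b i, b j) \<in> Y"
        using tau Y_D[of "b j" "b i"] Y_D[of "- b i" "- b j"] Y_D[of "- b j" "- b i"]
        by (auto simp: \<tau>_def)
      moreover from this have "b i = i" "b j = j" using Y_D[of "b i" "b j"] by (auto simp: b_def split: if_splits)
      ultimately show "(i, j) \<in> Y" by simp
    qed
    then show "Y = {p \<in> roots n. \<tau> (b (fst p)) (b (snd p))}" using Y by auto
  qed
qed

text \<open>This is the quotient of \<open>B_m\<close> by \<open>B_k\<close> times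
  \<open>S_(m-k)\<close>: the blocks \<open>{-k..k}\<close>, \<open>{k<..m}\<close> and its negative
  get the levels \<open>0\<close>, \<open>1\<close>, \<open>-1\<close>, and the split-off roots join
  two different ones. Indices beyond \<open>m\<close> have levels of absolute value at least
  \<open>2\<close>.\<close>

lemma inv_poly_signed_block:
  assumes "k < m" "m \<le> n" and T: "T \<subseteq> roots k \<union> {(i, j) \<in> roots m. int k < i}"
  shows "inv_poly x y n (T \<union> {(i, j) \<in> roots m. i \<le> int k \<and> int k < j}) =
    inv_poly x y n T * inv_poly x y n {(i, j) \<in> roots m. i \<le> int k \<and> int k < j}"
proof -
  define b where "b = (\<lambda>i. if \<bar>i\<bar> \<le> int k then 0 else if \<bar>i\<bar> \<le> int m then sgn i else i)"
  define \<tau> :: "int \<Rightarrow> int \<Rightarrow> bool" where "\<tau> c d \<longleftrightarrow> c \<noteq> d \<and> \<bar>c\<bar> \<le> 1 \<and> \<bar>d\<bar> \<le> 1" for c d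
  show ?thesis
  proof (rule inv_poly_parabolic[where b = b and \<tau> = \<tau>])
    show "odd_mono b" by (auto simp: odd_mono_def mono_def b_def sgn_if)
    show "T \<subseteq> roots n" using T assms roots_mono[of k n] roots_mono[of m n] by auto
    show "b i = b j" if "(i, j) \<in> T" for i j
      using that T by (auto simp: roots_def b_def)
    show "\<tau> c d \<longleftrightarrow> \<tau> d c" for c d by (auto simp: \<tau>_def)
    show "\<tau> c d \<longleftrightarrow> \<tau> (- c) (- d)" for c d by (auto simp: \<tau>_def)
    show "\<not> \<tau> c c" for c by (simp add: \<tau>_def)
    have "(i, j) \<in> roots m \<and> i \<le> int k \<and> int k < j \<longleftrightarrow> \<tau> (b i) (b j)" if "(i, j) \<in> roots n" for i j
    proof -
      have ij: "\<bar>i\<bar> < j" "j \<le> int n" using that by (auto simp: roots_def)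
      consider "j \<le> int k" | "int k < j" "j \<le> int m" | "int m < j" by linarith
      then show ?thesis
        by cases (use ij assms(1) in \<open>auto simp: roots_def b_def \<tau>_def sgn_if\<close>)
    qed
    then show "{(i, j) \<in> roots m. i \<le> int k \<and> int k < j} = {p \<in> roots n. \<tau> (b (fst p)) (b (snd p))}"
      using roots_mono[OF assms(2)] by fastforce
  qed
qed

text \<open>Here \<open>{1..k}\<close> has level \<open>1\<close> and \<open>{k<..m}\<close> has
  level \<open>2\<close>, so \<open>c * d = 2\<close> singles out the pairs between these blocks, up
  to negation. Beyond \<open>m\<close> the levels have absolute value at least \<open>4\<close> and
  cannot divide \<open>2\<close>.\<close>

lemma inv_poly_unsigned_block:
  assumes "k < m" "m \<le> n" and T: "T \<subseteq> pos_roots k \<union> {(i, j) \<in> roots m. int k < i}"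
  shows "inv_poly x y n (T \<union> {(i, j) \<in> pos_roots m. i \<le> int k \<and> int k < j}) =
    inv_poly x y n T * inv_poly x y n {(i, j) \<in> pos_roots m. i \<le> int k \<and> int k < j}"
proof -
  define b where "b = (\<lambda>i. if \<bar>i\<bar> \<le> int k then sgn i else if \<bar>i\<bar> \<le> int m then 2 * sgn i else 2 * i)"
  define \<tau> :: "int \<Rightarrow> int \<Rightarrow> bool" where "\<tau> c d \<longleftrightarrow> c * d = 2" for c d
  show ?thesis
  proof (rule inv_poly_parabolic[where b = b and \<tau> = \<tau>])
    show "odd_mono b" by (auto simp: odd_mono_def mono_def b_def sgn_if)
    show "T \<subseteq> roots n"
      using T assms roots_mono[of k n] roots_mono[of m n] by (auto simp: pos_roots_def)
    show "b i = b j" if "(i, j) \<in> T" for i j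
      using that T by (auto simp: roots_def pos_roots_def b_def)
    show "\<tau> c d \<longleftrightarrow> \<tau> d c" for c d by (auto simp: \<tau>_def mult.commute)
    show "\<tau> c d \<longleftrightarrow> \<tau> (- c) (- d)" for c d by (simp add: \<tau>_def)
    show "\<not> \<tau> c c" for c
    proof
      assume "\<tau> c c"
      then have c: "c * c = 2" by (simp add: \<tau>_def)
      have "2 * 2 \<le> \<bar>c\<bar> * \<bar>c\<bar>" if "2 \<le> \<bar>c\<bar>" using that by (intro mult_mono) auto
      then have "\<bar>c\<bar> \<le> 1" using c by fastforce
      then have "c \<in> {-1, 0, 1}" by auto
      then show False using c by auto
    qed
    have "(i, j) \<in> pos_roots m \<and> i \<le> int k \<and> int k < j \<longleftrightarrow> \<tau> (b i) (b j)" if "(i, j) \<in> roots n" for i j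
    proof -
      have ij: "\<bar>i\<bar> < j" "j \<le> int n" using that by (auto simp: roots_def)
      consider "j \<le> int k" | "int k < j" "j \<le> int m" | "int m < j" by linarith
      then show ?thesis
      proof cases
        case 3
        have "b i * j \<noteq> 1" using 3 assms(1) by (auto simp: zmult_eq_1_iff)
        then show ?thesis using 3 assms(1) by (auto simp: pos_roots_def roots_def b_def \<tau>_def)
      qed (use ij assms(1) in \<open>auto simp: pos_roots_def roots_def b_def \<tau>_def sgn_if\<close>)
    qed
    then show "{(i, j) \<in> pos_roots m. i \<le> int k \<and> int k < j} = {p \<in> roots n. \<tau> (b (fst p)) (b (snd p))}"
      using roots_mono[OF assms(2)] by (fastforce simp: pos_roots_def)
  qed
qed

section \<open>Evaluation of the factors by chains and quotients\<close>

lemma sum_root_inversions: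
  "(\<Sum>u\<in>{u \<in> signed_grp n. P (root_inversions n u)}. f (root_inversions n u)) =
    (\<Sum>X\<in>{X \<in> root_inversions n ` signed_grp n. P X}. f X)"
proof -
  have eq: "{X \<in> root_inversions n ` signed_grp n. P X} =
      root_inversions n ` {u \<in> signed_grp n. P (root_inversions n u)}" by blast
  show ?thesis unfolding eq
    by (subst sum.reindex) (auto intro: inj_on_subset[OF inj_on_root_inversions])
qed

lemma inv_poly_alt:
  "inv_poly x y n T = (\<Sum>X\<in>{X \<in> root_inversions n ` signed_grp n. X \<subseteq> T}.
     x ^ card X * y ^ (card T - card X))"
  unfolding inv_poly_def
  by (rule sum_root_inversions[where P = "\<lambda>X. X \<subseteq> T" and f = "\<lambda>X. x ^ card X * y ^ (card T - card X)"])

text \<open>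
  The elements whose inversions all have top index \<open>m\<close> form a chain: they are obtained from
  the identity by moving the entry at \<open>m\<close> down step by step.
\<close>

lemma inv_poly_chain:
  assumes m: "m \<le> int n" and a: "- m \<le> a" "a < m"
  shows "inv_poly x y n {(i, j). j = m \<and> a < i \<and> i < m} =
    (\<Sum>c\<in>{a..<m}. x ^ nat (m - 1 - c) * y ^ nat (c - a))"
proof -
  let ?T = "\<lambda>c. {(i, j). j = m \<and> c < i \<and> i < m}" and ?I = "root_inversions n"
  have T_eq: "?T c = (\<lambda>i. (i, m)) ` {c<..<m}" for c by auto
  have card: "card (?T c) = nat (m - 1 - c)" for c
    unfolding T_eq by (subst card_image) (auto intro: inj_onI)
  have T_inv: "?T c \<in> ?I ` signed_grp n" if c: "a \<le> c" "c < m" for c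
  proof -
    \<comment> \<open>Doubling makes room for the odd value \<open>2 * c + 1\<close>, which puts the
      entry at \<open>m\<close> strictly between \<open>2 * c\<close> and
      \<open>2 * (c + 1)\<close>.\<close>
    define f where "f = (\<lambda>i. if i = m then 2 * c + 1 else if i = - m then - (2 * c + 1) else 2 * i)"
    have "f (- i) = - f i" for i using a by (auto simp: f_def)
    moreover have "inj_on f {- int n..int n}" by (rule inj_onI) (auto simp: f_def split: if_splits, presburger+)
    ultimately obtain h where h: "h \<in> signed_grp n"
      and less: "\<And>i j. \<bar>i\<bar> \<le> int n \<Longrightarrow> \<bar>j\<bar> \<le> int n \<Longrightarrow> h i < h j \<longleftrightarrow> f i < f j"
      using standardization_exists[of f n] by blast
    have "(i, j) \<in> ?I h \<longleftrightarrow> (i, j) \<in> ?T c" for i j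
    proof (cases "\<bar>i\<bar> < j \<and> j \<le> int n")
      case True
      then have "\<bar>i\<bar> \<le> int n" "\<bar>j\<bar> \<le> int n" by auto
      then have "h j < h i \<longleftrightarrow> f j < f i" using less by blast
      then show ?thesis using True a c by (auto simp: root_inversions_def roots_def f_def)
    next
      case False
      then show ?thesis using a c m by (auto simp: root_inversions_def roots_def)
    qed
    then have "?I h = ?T c" by auto
    then show ?thesis using h by blast
  qed
  have inv_T: "\<exists>c\<in>{a..<m}. ?I u = ?T c" if u: "u \<in> signed_grp n" "?I u \<subseteq> ?T a" for u
  proof -
    let ?J = "{i \<in> {a<..<m}. (i, m) \<in> ?I u}"
    have fin: "finite ?J" by (rule finite_subset[of _ "{a<..<m}"]) auto
    \<comment> \<open>All inversions have top index \<open>m\<close>, so \<open>i < i'\<close> is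
      not inverted and \<open>u m < u i < u i'\<close>. The bound \<open>- m \<le> a < i\<close>
      excludes that \<open>(- i', - i)\<close> has top index \<open>m\<close>.\<close>
    have up: "(i', m) \<in> ?I u" if i: "i \<in> ?J" "i < i'" "i' < m" for i i'
    proof -
      have top: "q = m" if "(p, q) \<in> ?I u" for p q using that u(2) by blast
      have bounds: "a < i" "(i, m) \<in> ?I u" using i(1) by auto
      have "\<not> u i' < u i"
      proof
        assume less: "u i' < u i"
        have "\<bar>i\<bar> \<le> int n" "\<bar>i'\<bar> \<le> int n" using bounds i a m by auto
        from u(1) i(2) this less show False
          by (cases rule: inverted_pair_cases) (use top bounds i a in fastforce)+
      qed
      then show ?thesis using i a m by (auto simp: root_inversions_def roots_def)
    qed
    \<comment> \<open>The inverted pairs are to be those with \<open>i\<close> in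
      \<open>{c<..<m}\<close>; the default \<open>m - 1\<close> makes this range empty.\<close>
    define c where "c = (if ?J = {} then m - 1 else Min ?J - 1)"
    have c: "c \<in> {a..<m}"
    proof (cases "?J = {}")
      case False
      then have "Min ?J \<in> {a<..<m}" using Min_in[OF fin] by blast
      with False show ?thesis unfolding c_def by (simp only: if_False atLeastLessThan_iff greaterThanLessThan_iff) linarith
    qed (use a in \<open>simp add: c_def\<close>)
    have "i \<in> ?J \<longleftrightarrow> c < i" if "a < i" "i < m" for i
    proof (cases "?J = {}")
      case True
      then show ?thesis using that by (auto simp: c_def)
    next
      case False
      have "i \<in> ?J" if "Min ?J \<le> i"
        using up[of "Min ?J" i] Min_in[OF fin False] that \<open>a < i\<close> \<open>i < m\<close>
        by (cases "i = Min ?J") auto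
      moreover have "Min ?J \<le> i" if "i \<in> ?J" using Min_le[OF fin that] .
      moreover have "c < i \<longleftrightarrow> Min ?J \<le> i" unfolding c_def if_not_P[OF False] by linarith
      ultimately show ?thesis by blast
    qed
    then have "?I u = ?T c" using u(2) c by auto
    then show ?thesis using c by blast
  qed
  have "{X \<in> ?I ` signed_grp n. X \<subseteq> ?T a} = ?T ` {a..<m}"
  proof (intro equalityI subsetI)
    fix X assume "X \<in> ?T ` {a..<m}"
    then obtain c where c: "a \<le> c" "c < m" "X = ?T c" by auto
    have "?T c \<subseteq> ?T a" using c(1) by auto
    then show "X \<in> {X \<in> ?I ` signed_grp n. X \<subseteq> ?T a}" using T_inv[OF c(1,2)] c(3) by blast
  qed (use inv_T in blast)
  moreover have "inj_on ?T {a..<m}"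
  proof (rule inj_onI)
    fix c d assume cd: "c \<in> {a..<m}" "d \<in> {a..<m}" "?T c = ?T d"
    have "card (?T c) = card (?T d)" by (simp only: cd(3))
    then have "nat (m - 1 - c) = nat (m - 1 - d)" unfolding card .
    moreover have "c < m" "d < m" using cd(1,2) by simp_all
    ultimately show "c = d" by linarith
  qed
  ultimately have "inv_poly x y n (?T a) =
      (\<Sum>c\<in>{a..<m}. x ^ card (?T c) * y ^ (card (?T a) - card (?T c)))"
    unfolding inv_poly_alt by (simp add: sum.reindex)
  also have "\<dots> = (\<Sum>c\<in>{a..<m}. x ^ nat (m - 1 - c) * y ^ nat (c - a))"
  proof (rule sum.cong)
    fix c assume "c \<in> {a..<m}"
    then have "card (?T a) - card (?T c) = nat (c - a)" unfolding card by auto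
    then show "x ^ card (?T c) * y ^ (card (?T a) - card (?T c)) = x ^ nat (m - 1 - c) * y ^ nat (c - a)"
      by (simp add: card)
  qed simp
  finally show ?thesis .
qed

text \<open>Evaluation at \<open>1\<close> counts a set that contains \<open>id\<close>.
  Nonvanishing permits cancellation.\<close>

lemma inv_poly_nonzero:
  assumes "poly x 1 = 1" "poly y 1 = 1"
  shows "inv_poly x y n T \<noteq> 0"
proof -
  have "root_inversions n id = {}" by (auto simp: root_inversions_def roots_def)
  moreover have "id \<in> signed_grp n" by (simp add: signed_grp_def permutes_id)
  ultimately have "{u \<in> signed_grp n. root_inversions n u \<subseteq> T} \<noteq> {}" by auto
  moreover have "finite {u \<in> signed_grp n. root_inversions n u \<subseteq> T}"
    by (simp add: finite_signed_grp)
  ultimately have "card {u \<in> signed_grp n. root_inversions n u \<subseteq> T} \<noteq> 0"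
    by (simp only: card_eq_0_iff) blast
  moreover have "poly (inv_poly x y n T) 1 = int (card {u \<in> signed_grp n. root_inversions n u \<subseteq> T})"
    unfolding inv_poly_def by (simp add: poly_sum assms)
  ultimately have "poly (inv_poly x y n T) 1 \<noteq> 0" by (simp only: of_nat_eq_0_iff not_False_eq_True)
  then show ?thesis by (rule contrapos_nn) simp
qed

text \<open>The signed chain gives a sum of \<open>2 * Suc m\<close> terms. Its half with
  \<open>c < 0\<close>, shifted by \<open>Suc m\<close>, is the unsigned sum times
  \<open>x ^ Suc m\<close>; its half with \<open>c \<ge> 0\<close> is the unsigned sum times
  \<open>y ^ Suc m\<close>.\<close>

lemma inv_poly_chain_signed:
  assumes "Suc m \<le> n"
  shows "inv_poly x y n {(i, j). j = int (Suc m) \<and> - int (Suc m) < i \<and> i < int (Suc m)} =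
    inv_poly x y n {(i, j). j = int (Suc m) \<and> 0 < i \<and> i < int (Suc m)} * (x ^ Suc m + y ^ Suc m)"
proof -
  define M where "M = int (Suc m)"
  let ?f = "\<lambda>a c. x ^ nat (M - 1 - c) * y ^ nat (c - a)"
  have M: "nat M = Suc m" "0 < M" "M \<le> int n" using assms by (auto simp: M_def)
  have "(\<Sum>c\<in>{- M..<M}. ?f (- M) c) = (\<Sum>c\<in>{- M..<0}. ?f (- M) c) + (\<Sum>c\<in>{0..<M}. ?f (- M) c)"
    using M(2) by (subst sum.union_disjoint[symmetric]) (auto intro: sum.cong)
  also have "(\<Sum>c\<in>{- M..<0}. ?f (- M) c) = (\<Sum>c\<in>{0..<M}. ?f 0 c * x ^ Suc m)"
  proof (rule sum.reindex_bij_witness[where i = "\<lambda>c. c - M" and j = "\<lambda>c. c + M"])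
    fix c assume c: "c \<in> {- M..<0}"
    then have "nat (M - 1 - c) = nat (M - 1 - (c + M)) + Suc m" using M by auto
    then show "?f 0 (c + M) * x ^ Suc m = ?f (- M) c" by (simp add: power_add algebra_simps)
  qed auto
  also have "(\<Sum>c\<in>{0..<M}. ?f (- M) c) = (\<Sum>c\<in>{0..<M}. ?f 0 c * y ^ Suc m)"
  proof (rule sum.cong)
    fix c assume c: "c \<in> {0..<M}"
    then have "nat (c - - M) = nat (c - 0) + Suc m" using M by auto
    then show "?f (- M) c = ?f 0 c * y ^ Suc m" by (simp only: power_add algebra_simps)
  qed simp
  finally show ?thesis
    using inv_poly_chain[of M n "- M" x y] inv_poly_chain[of M n 0 x y] M
    by (simp add: M_def[symmetric] sum_distrib_right[symmetric] distrib_left del: power_Suc of_nat_Suc)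
qed

text \<open>Each induction step splits off the block of the single index \<open>Suc m\<close>. The
  roots with this top index form a chain in both cases, and the two chains differ by the new
  factor.\<close>

lemma inv_poly_roots:
  assumes "m \<le> n"
  shows "inv_poly x y n (roots m) = inv_poly x y n (pos_roots m) * (\<Prod>i\<in>{1..m}. x ^ i + y ^ i)"
  using assms
proof (induction m)
  case 0
  have "roots 0 = {}" "pos_roots 0 = {}" by (auto simp: roots_def pos_roots_def)
  then show ?case by simp
next
  case (Suc m)
  let ?B = "{(i, j). j = int (Suc m) \<and> - int (Suc m) < i \<and> i < int (Suc m)}"
  let ?S = "{(i, j). j = int (Suc m) \<and> 0 < i \<and> i < int (Suc m)}"
  have B: "{(i, j) \<in> roots (Suc m). i \<le> int m \<and> int m < j} = ?B"
    and S: "{(i, j) \<in> pos_roots (Suc m). i \<le> int m \<and> int m < j} = ?S"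
    by (auto simp: roots_def pos_roots_def)
  have "roots (Suc m) = roots m \<union> ?B" "pos_roots (Suc m) = pos_roots m \<union> ?S"
    by (auto simp: roots_def pos_roots_def)
  then have "inv_poly x y n (roots (Suc m)) = inv_poly x y n (roots m) * inv_poly x y n ?B"
    "inv_poly x y n (pos_roots (Suc m)) = inv_poly x y n (pos_roots m) * inv_poly x y n ?S"
    using inv_poly_signed_block[of m "Suc m" n "roots m" x y]
      inv_poly_unsigned_block[of m "Suc m" n "pos_roots m" x y] Suc.prems
    unfolding B S by simp_all
  moreover note inv_poly_chain_signed[OF Suc.prems, of x y]
  ultimately show ?case using Suc by (simp add: algebra_simps)
qed

text \<open>Both \<open>roots m\<close> and \<open>pos_roots m\<close> are factored at
  \<open>k\<close>, and \<open>inv_poly_roots\<close> relates them at \<open>m\<close> and at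
  \<open>k\<close>. The nonzero factors of \<open>roots k\<close> and of the roots inside
  \<open>{k<..m}\<close> then cancel.\<close>

lemma inv_poly_cross:
  assumes k: "k < m" "m \<le> n" and xy: "poly x 1 = 1" "poly y 1 = 1"
  shows "inv_poly x y n {(i, j) \<in> roots m. i \<le> int k \<and> int k < j} =
    inv_poly x y n {(i, j) \<in> pos_roots m. i \<le> int k \<and> int k < j} * (\<Prod>i\<in>{k<..m}. x ^ i + y ^ i)"
proof -
  let ?P = "inv_poly x y n"
  let ?B = "{(i, j) \<in> roots m. i \<le> int k \<and> int k < j}"
  let ?S = "{(i, j) \<in> pos_roots m. i \<le> int k \<and> int k < j}"
  let ?Y = "{(i, j) \<in> roots m. int k < i}"
  have split: "roots m = (roots k \<union> ?Y) \<union> ?B" "pos_roots m = (pos_roots k \<union> ?Y) \<union> ?S"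
    using k by (auto simp: roots_def pos_roots_def)
  have Y: "?Y \<subseteq> {(i, j) \<in> roots n. int k < i}" using roots_mono[OF k(2)] by auto
  have "?P (roots k) * ?P ?Y * ?P ?B = ?P (roots m)"
    by (subst split(1), subst inv_poly_signed_block[OF k], simp, subst inv_poly_product[OF _ _ Y])
      (use k in auto)
  also have "\<dots> = ?P (pos_roots m) * (\<Prod>i\<in>{1..m}. x ^ i + y ^ i)" by (rule inv_poly_roots[OF k(2)])
  also have "?P (pos_roots m) = ?P (pos_roots k) * ?P ?Y * ?P ?S"
    by (subst split(2), subst inv_poly_unsigned_block[OF k], simp, subst inv_poly_product[OF _ _ Y])
      (use k in \<open>auto simp: pos_roots_def\<close>)
  also have "(\<Prod>i\<in>{1..m}. x ^ i + y ^ i) = (\<Prod>i\<in>{1..k}. x ^ i + y ^ i) * (\<Prod>i\<in>{k<..m}. x ^ i + y ^ i)"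
    using k by (subst prod.union_disjoint[symmetric]) (auto intro!: prod.cong)
  also have "?P (pos_roots k) * ?P ?Y * ?P ?S * \<dots> =
      (?P (pos_roots k) * (\<Prod>i\<in>{1..k}. x ^ i + y ^ i)) * ?P ?Y * (?P ?S * (\<Prod>i\<in>{k<..m}. x ^ i + y ^ i))"
    by (simp only: mult_ac)
  also have "?P (pos_roots k) * (\<Prod>i\<in>{1..k}. x ^ i + y ^ i) = ?P (roots k)"
    using inv_poly_roots[of k n x y] k by simp
  finally have "?P (roots k) * ?P ?Y * ?P ?B =
      ?P (roots k) * ?P ?Y * (?P ?S * (\<Prod>i\<in>{k<..m}. x ^ i + y ^ i))" .
  then show ?thesis using inv_poly_nonzero[OF xy] by simp
qed

section \<open>Sign blocks\<close>

text \<open>This expresses avoidance of \<open>[-2, 1]\<close> and \<open>[2, -1]\<close> in a form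
  that, for nonzero entries, is invariant under negating all of them.\<close>

definition sign_monotone :: "nat \<Rightarrow> (int \<Rightarrow> int) \<Rightarrow> bool" where
  "sign_monotone n w \<longleftrightarrow> (\<forall>i j. 0 < i \<longrightarrow> i < j \<longrightarrow> j \<le> int n \<longrightarrow> (w i < 0) \<noteq> (w j < 0) \<longrightarrow> \<bar>w i\<bar> < \<bar>w j\<bar>)"

text \<open>For \<open>i < 0\<close>, \<open>w j\<close> is compared with \<open>- w (- i)\<close>.
  If \<open>w (- i)\<close> and \<open>w j\<close> have equal signs, these two lie on different
  sides of \<open>0\<close>; otherwise \<open>w j\<close> has the larger absolute value.\<close>

lemma sign_monotone_nonpos:
  assumes w: "w \<in> signed_grp n" and sm: "sign_monotone n w" and ij: "(i, j) \<in> roots n" "i \<le> 0"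
  shows "(i, j) \<in> root_inversions n w \<longleftrightarrow> w j < 0"
proof (cases "i = 0")
  case True
  then show ?thesis using ij signed_grp_zero[OF w] by (simp add: root_inversions_def)
next
  case False
  define k where "k = - i"
  have k: "0 < k" "k < j" "j \<le> int n" "w i = - w k"
    using ij False signed_grp_uminus[OF w, of k] by (auto simp: k_def roots_def)
  have "\<bar>w k\<bar> \<noteq> \<bar>w j\<bar>" using signed_grp_abs_eq_iff[OF w, of k j] k by simp
  then have "w j < - w k \<longleftrightarrow> w j < 0"
    using sm k(1-3) unfolding sign_monotone_def by (cases "(w k < 0) = (w j < 0)") force+
  then show ?thesis using ij k(4) by (simp add: root_inversions_def)
qed

text \<open>
  If the signs of \<open>w\<close> are constant on \<open>{k<..m}\<close> and change at \<open>k\<close>, then the entries there lie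
  all above or all below the entries at \<open>{1..k}\<close>.
\<close>

lemma sign_block_dominates:
  assumes w: "w \<in> signed_grp n" and sm: "sign_monotone n w" and ij: "0 < i" "i \<le> k" "k < j" "j \<le> int n"
    and change: "(w k < 0) \<noteq> (w j < 0)"
  shows "w j < w i \<longleftrightarrow> w j < 0"
proof -
  have kj: "\<bar>w k\<bar> < \<bar>w j\<bar>" using sm change ij unfolding sign_monotone_def by auto
  have "w i \<noteq> w j" using inj_eq[OF signed_grp_inj[OF w], of i j] ij by simp
  show ?thesis
  proof (cases "(w i < 0) = (w j < 0)")
    case True
    then have "i \<noteq> k" using change by blast
    \<comment> \<open>The entry at \<open>k\<close> has the opposite sign to both others and so
      separates their absolute values.\<close>
    then have "\<bar>w i\<bar> < \<bar>w k\<bar>" using sm change ij True unfolding sign_monotone_def by auto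
    then show ?thesis using kj True by linarith
  next
    case False
    then show ?thesis using \<open>w i \<noteq> w j\<close> by linarith
  qed
qed

text \<open>The induction is strong because removing the last block \<open>{k<..m}\<close> of
  constant sign passes from \<open>m\<close> to \<open>k\<close>. Inversions inside the block give
  the same factor on both sides, which leaves the roots with \<open>i \<le> k < j\<close>.\<close>

lemma inv_poly_sign_monotone:
  assumes w: "w \<in> signed_grp n" and sm: "sign_monotone n w"
    and xy: "poly x 1 = 1" "poly y 1 = 1" and "m \<le> n"
  shows "inv_poly x y n (root_inversions n w \<inter> roots m) =
    inv_poly x y n (root_inversions n w \<inter> pos_roots m) * (\<Prod>i | i \<in> {1..m} \<and> w (int i) < 0. x ^ i + y ^ i)"
  using \<open>m \<le> n\<close>
proof (induction m rule: less_induct)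
  case (less m)
  let ?P = "inv_poly x y n" and ?I = "root_inversions n w" and ?N = "\<lambda>m. {i. i \<in> {1..m} \<and> w (int i) < 0}"
  let ?f = "\<lambda>i. x ^ i + y ^ i"
  show ?case
  proof (cases "m = 0")
    case True
    then have "?I \<inter> roots m = {}" "?I \<inter> pos_roots m = {}" by (auto simp: pos_roots_def roots_def)
    then show ?thesis using True by simp
  next
    case False
    \<comment> \<open>Including \<open>0\<close> guarantees a maximum; \<open>k = 0\<close> means
      that all signs on \<open>{1..m}\<close> agree.\<close>
    define K where "K = {i. i < m \<and> (i = 0 \<or> (w (int i) < 0) \<noteq> (w (int m) < 0))}"
    define k where "k = Max K"
    have K: "finite K" "0 \<in> K" using False by (auto simp: K_def)
    then have "k \<in> K" unfolding k_def by (intro Max_in) auto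
    then have k: "k < m" "k = 0 \<or> (w (int k) < 0) \<noteq> (w (int m) < 0)" by (auto simp: K_def)
    have const: "(w (int i) < 0) = (w (int m) < 0)" if "k < i" "i \<le> m" for i
    proof (rule ccontr)
      assume ne: "(w (int i) < 0) \<noteq> (w (int m) < 0)"
      then have "i \<noteq> m" by blast
      then have "i \<in> K" using ne that by (simp add: K_def)
      then show False using Max_ge[OF K(1), of i] that(1) by (simp add: k_def)
    qed
    have top_sign: "w j < 0 \<longleftrightarrow> w (int m) < 0" if "int k < j" "j \<le> int m" for j
      using const[of "nat j"] that by simp
    \<comment> \<open>The sign of the block decides for all these roots at once: through
      \<open>sign_monotone_nonpos\<close> if \<open>i \<le> 0\<close>, through
      \<open>sign_block_dominates\<close> otherwise.\<close>
    have cross: "(i, j) \<in> ?I \<longleftrightarrow> w (int m) < 0" if "(i, j) \<in> roots m" "i \<le> int k" "int k < j" for i j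
    proof -
      have mem: "(i, j) \<in> roots n" "j \<le> int m"
        using that(1) roots_mono[OF less.prems] by (auto simp: roots_def)
      show ?thesis
      proof (cases "i \<le> 0")
        case True
        show ?thesis
          using sign_monotone_nonpos[OF w sm _ True, of j] top_sign[of j] that(3) mem by blast
      next
        case False
        then have "(w (int k) < 0) \<noteq> (w j < 0)"
          using k(2) that(2,3) top_sign[of j] mem(2) by auto
        then have "w j < w i \<longleftrightarrow> w j < 0"
          using sign_block_dominates[OF w sm, of i "int k" j] that(2,3) False mem(1)
          by (simp add: roots_def)
        then show ?thesis
          using that(3) top_sign[of j] mem by (simp add: root_inversions_def)
      qed
    qed
    let ?Y = "?I \<inter> {(i, j) \<in> roots m. int k < i}"
    let ?B = "{(i, j) \<in> roots m. i \<le> int k \<and> int k < j}"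
    let ?S = "{(i, j) \<in> pos_roots m. i \<le> int k \<and> int k < j}"
    have Y: "?Y \<subseteq> {(i, j) \<in> roots n. int k < i}" using roots_mono[OF less.prems] by auto
    have IH: "?P (?I \<inter> roots k) = ?P (?I \<inter> pos_roots k) * prod ?f (?N k)"
      using less k(1) by simp
    have "pos_roots k \<subseteq> roots k" by (auto simp: pos_roots_def)
    then have prods: "?P ((?I \<inter> roots k) \<union> ?Y) = ?P (?I \<inter> roots k) * ?P ?Y"
      "?P ((?I \<inter> pos_roots k) \<union> ?Y) = ?P (?I \<inter> pos_roots k) * ?P ?Y"
      using inv_poly_product[OF _ _ Y, of "?I \<inter> roots k" x y]
        inv_poly_product[OF _ _ Y, of "?I \<inter> pos_roots k" x y] less.prems k(1) by auto
    have parts: "?I \<inter> roots m = (?I \<inter> roots k) \<union> ?Y \<union> (?I \<inter> ?B)"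
      "?I \<inter> pos_roots m = (?I \<inter> pos_roots k) \<union> ?Y \<union> (?I \<inter> ?S)"
      using k(1) by (auto simp: roots_def pos_roots_def)
    show ?thesis
    proof (cases "w (int m) < 0")
      case True
      \<comment> \<open>Every crossing root is inverted, so \<open>inv_poly_cross\<close> supplies
        the factors of the new negative positions \<open>{k<..m}\<close>.\<close>
      have "?I \<inter> ?B = ?B" "?I \<inter> ?S = ?S" using cross True by (auto simp: pos_roots_def)
      then have "?P (?I \<inter> roots m) = ?P (?I \<inter> roots k) * ?P ?Y * ?P ?B"
        "?P (?I \<inter> pos_roots m) = ?P (?I \<inter> pos_roots k) * ?P ?Y * ?P ?S"
        unfolding parts
        using inv_poly_signed_block[OF k(1) less.prems, of "(?I \<inter> roots k) \<union> ?Y" x y]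
          inv_poly_unsigned_block[OF k(1) less.prems, of "(?I \<inter> pos_roots k) \<union> ?Y" x y]
        by (auto simp: prods)
      moreover have "?N m = ?N k \<union> {k<..m}" using const True k(1) by auto
      then have "prod ?f (?N m) = prod ?f (?N k) * prod ?f {k<..m}"
        by (simp only:) (rule prod.union_disjoint, auto)
      moreover note inv_poly_cross[OF k(1) less.prems xy]
      ultimately show ?thesis using IH by (simp only: mult_ac)
    next
      case False
      have "?I \<inter> ?B = {}" "?I \<inter> ?S = {}" using cross False by (auto simp: pos_roots_def)
      moreover have "i \<in> ?N m \<longleftrightarrow> i \<in> ?N k" for i
        using const[of i] False k(1) by (cases "k < i") auto
      then have "?N m = ?N k" by blast
      ultimately show ?thesis unfolding parts using IH prods by (simp only: Un_empty_right mult_ac)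
    qed
  qed
qed

section \<open>Weak order intervals\<close>

lemma st_inversions: "inversions n (st n w) = inversions n w"
  by (auto simp: inversions_def st_less_iff)

lemma inversions_eq: "inversions n u = root_inversions n u \<inter> pos_roots n"
  by (auto simp: inversions_def root_inversions_def pos_roots_def roots_def)

text \<open>This embeds \<open>S_n\<close> into \<open>B_n\<close>, so that weak order in
  \<open>S_n\<close> can be read off there.\<close>

definition odd_extension :: "(int \<Rightarrow> int) \<Rightarrow> int \<Rightarrow> int" where
  "odd_extension v i = (if i \<ge> 0 then v i else - v (- i))"

lemma sym_grp_pos:
  assumes "v \<in> sym_grp n"
  shows "0 < i \<Longrightarrow> 0 < v i" "i \<le> 0 \<Longrightarrow> v i = i"
proof -
  have perm: "v permutes {1..int n}" using assms by (simp add: sym_grp_def)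
  show "0 < v i" if "0 < i"
    using permutes_in_image[OF perm, of i] permutes_not_in[OF perm, of i] that
    by (cases "i \<in> {1..int n}") auto
  show "v i = i" if "i \<le> 0" using permutes_not_in[OF perm, of i] that by simp
qed

lemma odd_extension_comp:
  assumes "v \<in> sym_grp n"
  shows "odd_extension (u \<circ> v) = odd_extension u \<circ> odd_extension v"
proof
  fix i
  show "odd_extension (u \<circ> v) i = (odd_extension u \<circ> odd_extension v) i"
    using sym_grp_pos(1)[OF assms, of i] sym_grp_pos(1)[OF assms, of "- i"] sym_grp_pos(2)[OF assms, of 0]
    by (cases i "0 :: int" rule: linorder_cases) (simp_all add: odd_extension_def)
qed

lemma odd_extension_id: "odd_extension id = id"
  by (auto simp: odd_extension_def)

lemma sym_grp_inv:
  assumes "v \<in> sym_grp n"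
  shows "inv v \<in> sym_grp n" "v \<circ> inv v = id" "inv v \<circ> v = id"
  using assms permutes_inv permutes_inv_o[of v "{1..int n}"] by (auto simp: sym_grp_def)

lemma sym_grp_comp: "u \<in> sym_grp n \<Longrightarrow> v \<in> sym_grp n \<Longrightarrow> u \<circ> v \<in> sym_grp n"
  by (simp add: sym_grp_def permutes_compose)

lemma odd_extension_inv:
  assumes "v \<in> sym_grp n"
  shows "odd_extension v \<circ> odd_extension (inv v) = id" "odd_extension (inv v) \<circ> odd_extension v = id"
  using odd_extension_comp[OF assms, of "inv v"] odd_extension_comp[OF sym_grp_inv(1)[OF assms], of v]
  by (simp_all add: sym_grp_inv[OF assms] odd_extension_id)

lemma odd_extension_in:
  assumes v: "v \<in> sym_grp n"
  shows "odd_extension v \<in> signed_grp n"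
proof -
  let ?A = "{- int n..int n} - {0}"
  have maps: "odd_extension u i \<in> ?A" if "u \<in> sym_grp n" "i \<in> ?A" for u i
  proof -
    have perm: "u permutes {1..int n}" using that(1) by (simp add: sym_grp_def)
    show ?thesis
      using permutes_in_image[OF perm, of i] permutes_in_image[OF perm, of "- i"] that(2)
      by (auto simp: odd_extension_def)
  qed
  have "bij_betw (odd_extension v) ?A ?A"
  proof (rule bij_betw_byWitness[where f' = "odd_extension (inv v)"])
    show "\<forall>i\<in>?A. odd_extension (inv v) (odd_extension v i) = i"
      "\<forall>i\<in>?A. odd_extension v (odd_extension (inv v) i) = i"
      using odd_extension_inv[OF v] by (simp_all add: fun_eq_iff)
    show "odd_extension v ` ?A \<subseteq> ?A" by (rule image_subsetI) (rule maps[OF v])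
    show "odd_extension (inv v) ` ?A \<subseteq> ?A"
      by (rule image_subsetI) (rule maps[OF sym_grp_inv(1)[OF v]])
  qed
  moreover have "odd_extension v i = i" if "i \<notin> ?A" for i
  proof -
    have perm: "v permutes {1..int n}" using v by (simp add: sym_grp_def)
    show ?thesis
      using permutes_not_in[OF perm, of i] permutes_not_in[OF perm, of "- i"] that
      by (auto simp: odd_extension_def)
  qed
  ultimately have "odd_extension v permutes ?A" by (rule bij_imp_permutes)
  moreover have "odd_extension v (- i) = - odd_extension v i" for i
    using sym_grp_pos(2)[OF v, of 0] by (cases i "0 :: int" rule: linorder_cases) (simp_all add: odd_extension_def)
  ultimately show ?thesis unfolding signed_grp_def by blast
qed

text \<open>Positive indices keep positive values, so no root with \<open>i \<le> 0\<close> is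
  inverted.\<close>

lemma root_inversions_odd_extension:
  assumes v: "v \<in> sym_grp n"
  shows "root_inversions n (odd_extension v) = inversions n v"
proof -
  have "(i, j) \<in> root_inversions n (odd_extension v) \<longleftrightarrow> (i, j) \<in> inversions n v" for i j
  proof (cases "0 < i")
    case True
    then show ?thesis
      by (auto simp: root_inversions_def roots_def inversions_def odd_extension_def)
  next
    case False
    then have "odd_extension v i \<le> 0"
      using sym_grp_pos(1)[OF v, of "- i"] sym_grp_pos(2)[OF v, of 0]
      by (cases "i = 0") (simp_all add: odd_extension_def)
    moreover have "0 < odd_extension v j" if "\<bar>i\<bar> < j"
    proof -
      have "0 < j" using that by linarith
      then show ?thesis using sym_grp_pos(1)[OF v] by (simp add: odd_extension_def)
    qed
    ultimately show ?thesis
      using False by (fastforce simp: root_inversions_def roots_def inversions_def)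
  qed
  then show ?thesis by auto
qed

lemma length_S_odd_extension: "v \<in> sym_grp n \<Longrightarrow> length_S n v = length_B n (odd_extension v)"
  by (simp add: length_S_explicit length_B_root_inversions odd_extension_in root_inversions_odd_extension)

lemma left_weak_le_S_iff:
  assumes u: "u \<in> sym_grp n" and v: "v \<in> sym_grp n"
  shows "left_weak_le (length_S n) u v \<longleftrightarrow> inversions n u \<subseteq> inversions n v"
proof -
  have "inv (odd_extension u) = odd_extension (inv u)"
    using odd_extension_inv[OF u] by (rule inv_unique_comp)
  then have "length_S n (v \<circ> inv u) = length_B n (odd_extension v \<circ> inv (odd_extension u))"
    using length_S_odd_extension[OF sym_grp_comp[OF v sym_grp_inv(1)[OF u]]]
      odd_extension_comp[OF sym_grp_inv(1)[OF u], of v] by simp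
  then have "left_weak_le (length_S n) u v \<longleftrightarrow>
      left_weak_le (length_B n) (odd_extension u) (odd_extension v)"
    using u v by (simp add: left_weak_le_def length_S_odd_extension)
  also have "\<dots> \<longleftrightarrow> inversions n u \<subseteq> inversions n v"
    using left_weak_le_B_iff[OF odd_extension_in[OF u] odd_extension_in[OF v]]
    by (simp add: root_inversions_odd_extension u v)
  finally show ?thesis .
qed

lemma inj_on_inversions: "inj_on (inversions n) (sym_grp n)"
proof (rule inj_onI)
  fix u v assume uv: "u \<in> sym_grp n" "v \<in> sym_grp n" "inversions n u = inversions n v"
  have "odd_extension u = odd_extension v"
    by (rule inj_onD[OF inj_on_root_inversions[of n]])
      (simp_all add: uv root_inversions_odd_extension odd_extension_in)
  then have "odd_extension u i = odd_extension v i" for i by simp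
  from this have "u i = v i" if "0 \<le> i" for i using that unfolding odd_extension_def by metis
  moreover have "u i = v i" if "i \<le> 0" for i
    using that sym_grp_pos(2)[OF uv(1)] sym_grp_pos(2)[OF uv(2)] by simp
  ultimately show "u = v" by (metis ext linear)
qed

lemma inversions_in_root_inversions:
  assumes "u \<in> signed_grp n"
  shows "inversions n u \<in> root_inversions n ` signed_grp n"
proof -
  have "st n u \<in> sym_grp n" using st_in_sym_grp[OF signed_grp_inj[OF assms]] .
  then have "inversions n u = root_inversions n (odd_extension (st n u))"
    "odd_extension (st n u) \<in> signed_grp n"
    by (simp_all add: root_inversions_odd_extension st_inversions odd_extension_in)
  then show ?thesis by blast
qed

text \<open>A signed permutation with inversions only in \<open>pos_roots n\<close> has the same
  inversions as its standardization. Sums over \<open>S_n\<close> thus run over the index sets of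
  \<open>inv_poly\<close>.\<close>

lemma inversions_image:
  "inversions n ` sym_grp n = {X \<in> root_inversions n ` signed_grp n. X \<subseteq> pos_roots n}"
proof (intro equalityI subsetI)
  fix X assume "X \<in> inversions n ` sym_grp n"
  then obtain v where v: "v \<in> sym_grp n" "X = root_inversions n (odd_extension v)"
    using root_inversions_odd_extension by blast
  have "X \<subseteq> pos_roots n"
    unfolding v(2) root_inversions_odd_extension[OF v(1)] inversions_eq by blast
  then show "X \<in> {X \<in> root_inversions n ` signed_grp n. X \<subseteq> pos_roots n}"
    using v odd_extension_in by blast
next
  fix X assume "X \<in> {X \<in> root_inversions n ` signed_grp n. X \<subseteq> pos_roots n}"
  then obtain u where u: "u \<in> signed_grp n" "X = root_inversions n u" "X \<subseteq> pos_roots n" by blast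
  then have "X = inversions n (st n u)"
    unfolding st_inversions unfolding inversions_eq by (simp only: Int_absorb2)
  then show "X \<in> inversions n ` sym_grp n"
    using st_in_sym_grp[OF signed_grp_inj[OF u(1)]] by blast
qed

lemma root_inversions_neg:
  assumes u: "u \<in> signed_grp n"
  shows "root_inversions n (\<lambda>i. if \<bar>i\<bar> \<le> int n then - u i else i) = roots n - root_inversions n u"
proof -
  have "u i \<noteq> u j" if "\<bar>i\<bar> < j" for i j
    using inj_eq[OF signed_grp_inj[OF u], of i j] that by auto
  then show ?thesis by (fastforce simp: root_inversions_def roots_def)
qed

lemma root_inversions_compl:
  assumes "X \<in> root_inversions n ` signed_grp n"
  shows "roots n - X \<in> root_inversions n ` signed_grp n" "pos_roots n - X \<in> root_inversions n ` signed_grp n"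
proof -
  obtain u where u: "u \<in> signed_grp n" "X = root_inversions n u" using assms by blast
  let ?v = "\<lambda>i. if \<bar>i\<bar> \<le> int n then - u i else i"
  have v: "?v \<in> signed_grp n" using signed_grp_neg[OF u(1)] .
  show "roots n - X \<in> root_inversions n ` signed_grp n"
    using v root_inversions_neg[OF u(1)] u(2) by blast
  have "pos_roots n - X = inversions n ?v"
    unfolding inversions_eq root_inversions_neg[OF u(1)] u(2) by (auto simp: pos_roots_def)
  then show "pos_roots n - X \<in> root_inversions n ` signed_grp n"
    using inversions_in_root_inversions[OF v] by simp
qed

text \<open>Complementation in \<open>E\<close> turns the sets between \<open>A\<close> and
  \<open>E\<close> into the subsets of \<open>E - A\<close>, and \<open>card X - card A\<close> into
  the number of elements of \<open>E - A\<close> outside \<open>E - X\<close>, the exponent of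
  \<open>y\<close>.\<close>

lemma sum_upper_interval:
  assumes fin: "finite E" and A: "A \<subseteq> E"
    and compl: "\<And>X. X \<in> root_inversions n ` signed_grp n \<Longrightarrow> E - X \<in> root_inversions n ` signed_grp n"
  shows "(\<Sum>X\<in>{X \<in> root_inversions n ` signed_grp n. A \<subseteq> X \<and> X \<subseteq> E}. monom 1 (card X - card A)) =
    inv_poly 1 (monom 1 1) n (E - A)"
  unfolding inv_poly_alt
proof (rule sum.reindex_bij_witness[where i = "\<lambda>X. E - X" and j = "\<lambda>X. E - X"])
  fix X assume X: "X \<in> {X \<in> root_inversions n ` signed_grp n. A \<subseteq> X \<and> X \<subseteq> E}"
  then have finX: "finite X" "finite A"
    using finite_subset[OF _ fin, of X] finite_subset[OF A fin] by simp_all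
  have "card X \<le> card E" "card A \<le> card X" using X fin finX by (auto intro: card_mono)
  moreover have "card (E - A) = card E - card A" "card (E - X) = card E - card X"
    using X A finX by (auto intro: card_Diff_subset)
  ultimately have "card (E - A) - card (E - X) = card X - card A" by simp
  then show "1 ^ card (E - X) * monom 1 1 ^ (card (E - A) - card (E - X)) = monom 1 (card X - card A)"
    by (simp add: monom_power)
  show "E - X \<in> {X \<in> root_inversions n ` signed_grp n. X \<subseteq> E - A}" using X compl[of X] by blast
  show "E - (E - X) = X" using X by blast
next
  fix X assume X: "X \<in> {X \<in> root_inversions n ` signed_grp n. X \<subseteq> E - A}"
  show "E - X \<in> {X \<in> root_inversions n ` signed_grp n. A \<subseteq> X \<and> X \<subseteq> E}"
    using X A compl[of X] by blast
  show "E - (E - X) = X" using X by blast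
qed

lemma sum_inversions:
  "(\<Sum>u\<in>{u \<in> sym_grp n. P (inversions n u)}. f (inversions n u)) =
    (\<Sum>X\<in>{X \<in> root_inversions n ` signed_grp n. P X \<and> X \<subseteq> pos_roots n}. f X)"
proof -
  have "{X \<in> root_inversions n ` signed_grp n. P X \<and> X \<subseteq> pos_roots n} = {X \<in> inversions n ` sym_grp n. P X}"
    unfolding inversions_image by blast
  also have "\<dots> = inversions n ` {u \<in> sym_grp n. P (inversions n u)}" by blast
  finally show ?thesis
    by (simp only:) (subst sum.reindex, auto intro: inj_on_subset[OF inj_on_inversions])
qed

section \<open>The four generating functions as inversion polynomials\<close>

lemma F_Lambda_S_inv_poly:
  assumes v: "v \<in> sym_grp n"
  shows "F_Lambda_S n v = inv_poly (monom 1 1) 1 n (inversions n v)"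
proof -
  have "F_Lambda_S n v = (\<Sum>u\<in>{u \<in> sym_grp n. inversions n u \<subseteq> inversions n v}. monom 1 (card (inversions n u)))"
    unfolding F_Lambda_S_def Lambda_S_def
    by (rule sum.cong) (auto simp: left_weak_le_S_iff[OF _ v] length_S_explicit)
  also have "\<dots> = (\<Sum>X\<in>{X \<in> root_inversions n ` signed_grp n. X \<subseteq> inversions n v \<and> X \<subseteq> pos_roots n}. monom 1 (card X))"
    by (rule sum_inversions)
  also have "\<dots> = (\<Sum>X\<in>{X \<in> root_inversions n ` signed_grp n. X \<subseteq> inversions n v}. monom 1 (card X))"
  proof (rule sum.cong)
    have "X \<subseteq> pos_roots n" if "X \<subseteq> inversions n v" for X using that inversions_eq[of n v] by blast
    then show "{X \<in> root_inversions n ` signed_grp n. X \<subseteq> inversions n v \<and> X \<subseteq> pos_roots n} =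
        {X \<in> root_inversions n ` signed_grp n. X \<subseteq> inversions n v}" by blast
  qed simp
  finally show ?thesis by (simp add: inv_poly_alt monom_power)
qed

lemma F_V_S_inv_poly:
  assumes v: "v \<in> sym_grp n"
  shows "F_V_S n v = inv_poly 1 (monom 1 1) n (pos_roots n - inversions n v)"
proof -
  let ?A = "inversions n v"
  have "F_V_S n v = (\<Sum>u\<in>{u \<in> sym_grp n. ?A \<subseteq> inversions n u}. monom 1 (card (inversions n u) - card ?A))"
    unfolding F_V_S_def V_S_def
    by (rule sum.cong) (auto simp: left_weak_le_S_iff[OF v] length_S_explicit v)
  also have "\<dots> = (\<Sum>X\<in>{X \<in> root_inversions n ` signed_grp n. ?A \<subseteq> X \<and> X \<subseteq> pos_roots n}. monom 1 (card X - card ?A))"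
    by (rule sum_inversions)
  also have "\<dots> = inv_poly 1 (monom 1 1) n (pos_roots n - ?A)"
  proof (rule sum_upper_interval)
    show "finite (pos_roots n)" by (rule finite_subset[OF _ finite_roots[of n]]) (auto simp: pos_roots_def)
    show "?A \<subseteq> pos_roots n" by (simp add: inversions_eq)
  qed (rule root_inversions_compl(2))
  finally show ?thesis .
qed

lemma F_Lambda_B_inv_poly:
  assumes w: "w \<in> signed_grp n"
  shows "F_Lambda_B n w = inv_poly (monom 1 1) 1 n (root_inversions n w)"
  unfolding F_Lambda_B_def Lambda_B_def inv_poly_def
  by (rule sum.cong) (auto simp: left_weak_le_B_iff[OF _ w] length_B_root_inversions monom_power)

lemma F_V_B_inv_poly:
  assumes w: "w \<in> signed_grp n"
  shows "F_V_B n w = inv_poly 1 (monom 1 1) n (roots n - root_inversions n w)"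
proof -
  let ?A = "root_inversions n w"
  have "F_V_B n w = (\<Sum>u\<in>{u \<in> signed_grp n. ?A \<subseteq> root_inversions n u \<and> root_inversions n u \<subseteq> roots n}.
      monom 1 (card (root_inversions n u) - card ?A))"
    unfolding F_V_B_def V_B_def
    by (rule sum.cong)
      (auto simp: left_weak_le_B_iff[OF w] length_B_root_inversions w dest: subsetD[OF root_inversions_subset])
  also have "\<dots> = (\<Sum>X\<in>{X \<in> root_inversions n ` signed_grp n. ?A \<subseteq> X \<and> X \<subseteq> roots n}. monom 1 (card X - card ?A))"
    by (rule sum_root_inversions)
  also have "\<dots> = inv_poly 1 (monom 1 1) n (roots n - ?A)"
    by (rule sum_upper_interval) (simp_all add: root_inversions_subset root_inversions_compl(1))
  finally show ?thesis .
qed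

section \<open>Pattern avoidance and conclusion\<close>

lemma sts_pair:
  assumes "\<bar>b\<bar> < \<bar>a\<bar>"
  shows "sts [a, b] = [2 * sgn a, sgn b]"
proof -
  have "{y \<in> set [a, b]. \<bar>y\<bar> \<le> \<bar>a\<bar>} = {a, b}" "{y \<in> set [a, b]. \<bar>y\<bar> \<le> \<bar>b\<bar>} = {b}" "a \<noteq> b"
    using assms by auto
  then show ?thesis unfolding sts_def by (simp only: list.map) simp
qed

text \<open>Entries of opposite sign with decreasing absolute values would form a two-letter subword
  with pattern \<open>[-2, 1]\<close> or \<open>[2, -1]\<close>.\<close>

lemma separable_sign_monotone:
  assumes "w \<in> separable_signed n"
  shows "sign_monotone n w"
  unfolding sign_monotone_def
proof (intro allI impI)
  fix i j assume ij: "0 < i" "i < j" "j \<le> int n" "(w i < 0) \<noteq> (w j < 0)"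
  have w: "w \<in> signed_grp n" using assms by (simp add: separable_signed_def)
  have avoid: "\<not> contains_pattern n w [- 2, 1]" "\<not> contains_pattern n w [2, - 1]"
    using assms by (simp_all add: separable_signed_def)
  have ne: "\<bar>w i\<bar> \<noteq> \<bar>w j\<bar>" "w i \<noteq> 0" "w j \<noteq> 0"
    using signed_grp_abs_eq_iff[OF w, of i j] signed_grp_abs_eq_iff[OF w, of i 0]
      signed_grp_abs_eq_iff[OF w, of j 0] signed_grp_zero[OF w] ij by auto
  show "\<bar>w i\<bar> < \<bar>w j\<bar>"
  proof (rule ccontr)
    assume "\<not> \<bar>w i\<bar> < \<bar>w j\<bar>"
    then have "sts (map w [i, j]) = [2 * sgn (w i), sgn (w j)]"
      using sts_pair[of "w j" "w i"] ne(1) by simp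
    then have "sts (map w [i, j]) = [- 2, 1] \<or> sts (map w [i, j]) = [2, - 1]"
      using ij(4) ne by (cases "w i < 0") auto
    moreover have "sorted_wrt (<) [i, j]" "set [i, j] \<subseteq> {1..int n}" using ij by auto
    ultimately have "contains_pattern n w [- 2, 1] \<or> contains_pattern n w [2, - 1]"
      unfolding contains_pattern_def by (metis length_Cons list.size(3))
    then show False using avoid by blast
  qed
qed

lemma prod_q_paren:
  "(\<Prod>i | i \<in> {1..n} \<and> P (int i). 1 + monom 1 1 ^ i) = (\<Prod>i\<in>{i \<in> {1..int n}. P i}. q_paren i)"
  by (rule prod.reindex_bij_witness[where i = nat and j = int])
    (auto simp: q_paren_def monom_power)

theorem lemma5p7:
  fixes n :: nat and w :: "int \<Rightarrow> int"
  assumes "n \<ge> 1" and "w \<in> separable_signed n"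
  shows "F_Lambda_B n w = F_Lambda_S n (st n w) * (\<Prod>i\<in>Neg n w. q_paren i) \<and>
         F_V_B n w = F_V_S n (st n w) * (\<Prod>i\<in>{1..int n} - Neg n w. q_paren i)"
proof
  let ?q = "monom 1 1 :: int poly"
  have w: "w \<in> signed_grp n" using assms(2) by (simp add: separable_signed_def)
  have sm: "sign_monotone n w" using separable_sign_monotone[OF assms(2)] .
  have st: "st n w \<in> sym_grp n" using st_in_sym_grp[OF signed_grp_inj[OF w]] .
  have eval: "poly ?q 1 = 1" "poly (1 :: int poly) 1 = 1" by (simp_all add: poly_monom)
  have roots: "root_inversions n u \<inter> roots n = root_inversions n u" for u
    using root_inversions_subset by blast
  show "F_Lambda_B n w = F_Lambda_S n (st n w) * (\<Prod>i\<in>Neg n w. q_paren i)"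
    using inv_poly_sign_monotone[OF w sm eval order_refl]
    unfolding F_Lambda_B_inv_poly[OF w] F_Lambda_S_inv_poly[OF st] st_inversions
    unfolding inversions_eq roots Neg_def prod_q_paren[symmetric]
    by (simp only: power_one add.commute)
  \<comment> \<open>Passing to \<open>-w\<close> complements both the inversion set and the set of
    negative positions, so the same identity at \<open>x = 1\<close>, \<open>y = q\<close> gives the
    upper interval.\<close>
  let ?v = "\<lambda>i. if \<bar>i\<bar> \<le> int n then - w i else i"
  have v: "?v \<in> signed_grp n" using signed_grp_neg[OF w] .
  have nz: "w i \<noteq> 0" if "i \<in> {1..int n}" for i
    using signed_grp_abs_eq_iff[OF w, of i 0] signed_grp_zero[OF w] that by auto
  have "sign_monotone n ?v"
    unfolding sign_monotone_def
  proof (intro allI impI)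
    fix i j assume ij: "0 < i" "i < j" "j \<le> int n" "(?v i < 0) \<noteq> (?v j < 0)"
    then have "(w i < 0) \<noteq> (w j < 0)" using nz[of i] nz[of j] by auto
    then show "\<bar>?v i\<bar> < \<bar>?v j\<bar>" using sm ij unfolding sign_monotone_def by auto
  qed
  note main = inv_poly_sign_monotone[OF v this eval(2,1) order_refl]
  have "pos_roots n - inversions n w = root_inversions n ?v \<inter> pos_roots n"
    unfolding root_inversions_neg[OF w] inversions_eq by (auto simp: pos_roots_def)
  moreover have "{1..int n} - Neg n w = {i \<in> {1..int n}. ?v i < 0}"
    using nz by (force simp: Neg_def)
  ultimately show "F_V_B n w = F_V_S n (st n w) * (\<Prod>i\<in>{1..int n} - Neg n w. q_paren i)"
    using main
    unfolding F_V_B_inv_poly[OF w] F_V_S_inv_poly[OF st] st_inversions roots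
      root_inversions_neg[OF w, symmetric]
    by (simp only: power_one prod_q_paren[where P = "\<lambda>i. ?v i < 0"])
qed

end
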